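(* Let $B_1\subset\mathbb{R}^d$ be the unit ball, let $g\in H^1(B_1)$ be non-negative, and let $\varphi\in\mathcal K_{ob}$ be the solution of the obstacle problem $\min_{u\in\mathcal K_{ob}}\mathcal F_{ob}(u)$. Then there is a dimensional constant $C_d>0$ such that $$\big(\mathcal F_{ob}(u)-\mathcal F_{ob}(\varphi)\big)^{1/2}\le C_d\,\|\nabla\mathcal F_{ob}(u)\|_{\mathcal K_{ob}}\qquad\text{for every }u\in H^2(B_1)\cap\mathcal K_{ob}.$$
   Context: $\mathcal K_{ob}=\{u\in H^1(B_1):u-g\in H^1_0(B_1),\ u\ge0\text{ in }B_1\}$ and $\mathcal F_{ob}(u)=\frac12\int_{B_1}|\nabla u|^2\,dx+\int_{B_1}u\,dx$. For $u\in H^2(B_1)$, $\nabla\mathcal F_{ob}(u)=-\Delta u+1\in L^2(B_1)$, and for $u\in H^2(B_1)\cap\mathcal K_{ob}$ $$\|\nabla\mathcal F_{ob}(u)\|_{\mathcal K_{ob}}:=\sup\Big\{0,\ \sup_{v\in\mathcal K_{ob}\setminus\{u\}}\frac{-\int_{B_1}(v-u)(-\Delta u+1)\,dx}{\|v-u\|_{L^2(B_1)}}\Big\}.$$ "Dimensional" means depending only on $d$ (not on $g$). *)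

theory Defs
  imports "HOL-Analysis.Analysis"
begin

text \<open>Elements of Lebesgue and Sobolev spaces are represented by functions defined everywhere.
  Membership in these spaces, and the functionals on them, depend only on the values almost
  everywhere in the domain.\<close>

definition L2_space :: "'a::euclidean_space set \<Rightarrow> ('a \<Rightarrow> real) set" where
  "L2_space \<Omega> = {u. u \<in> borel_measurable (lebesgue_on \<Omega>) \<and> integrable (lebesgue_on \<Omega>) (\<lambda>x. (u x)\<^sup>2)}"

definition L2_norm :: "'a::euclidean_space set \<Rightarrow> ('a \<Rightarrow> real) \<Rightarrow> real" where
  "L2_norm \<Omega> u = sqrt (LINT x|lebesgue_on \<Omega>. (u x)\<^sup>2)"

definition locally_integrable :: "'a::euclidean_space set \<Rightarrow> ('a \<Rightarrow> real) \<Rightarrow> bool" where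
  "locally_integrable \<Omega> u \<longleftrightarrow> (\<forall>K. compact K \<and> K \<subseteq> \<Omega> \<longrightarrow> integrable (lebesgue_on K) u)"

definition pderivative :: "'a::euclidean_space \<Rightarrow> ('a \<Rightarrow> real) \<Rightarrow> 'a \<Rightarrow> real" where
  "pderivative i f x = frechet_derivative f (at x) i"

text \<open>Requiring total differentiability at each step does not change the class
  of \<open>k\<close> times continuously differentiable functions.\<close>

primrec Ck :: "nat \<Rightarrow> ('a::euclidean_space \<Rightarrow> real) \<Rightarrow> bool" where
  "Ck 0 f \<longleftrightarrow> continuous_on UNIV f"
| "Ck (Suc k) f \<longleftrightarrow> f differentiable_on UNIV \<and> (\<forall>i\<in>Basis. Ck k (pderivative i f))"

definition test_functions :: "'a::euclidean_space set \<Rightarrow> ('a \<Rightarrow> real) set" where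
  "test_functions \<Omega> =
     {\<psi>. (\<forall>k. Ck k \<psi>) \<and> compact (closure {x. \<psi> x \<noteq> 0}) \<and> closure {x. \<psi> x \<noteq> 0} \<subseteq> \<Omega>}"

definition has_weak_partial ::
  "'a::euclidean_space set \<Rightarrow> 'a \<Rightarrow> ('a \<Rightarrow> real) \<Rightarrow> ('a \<Rightarrow> real) \<Rightarrow> bool" where
  "has_weak_partial \<Omega> i u w \<longleftrightarrow>
     locally_integrable \<Omega> u \<and> locally_integrable \<Omega> w \<and>
     (\<forall>\<psi>\<in>test_functions \<Omega>.
        (LINT x|lebesgue_on \<Omega>. u x * pderivative i \<psi> x) = - (LINT x|lebesgue_on \<Omega>. w x * \<psi> x))"

text \<open>A representative of the weak partial derivative, which on an open set is unique up to
  null sets.  The value is meaningful only if a weak partial derivative exists.\<close>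

definition weak_partial :: "'a::euclidean_space set \<Rightarrow> 'a \<Rightarrow> ('a \<Rightarrow> real) \<Rightarrow> 'a \<Rightarrow> real" where
  "weak_partial \<Omega> i u = (SOME w. has_weak_partial \<Omega> i u w)"

definition weak_gradient :: "'a::euclidean_space set \<Rightarrow> ('a \<Rightarrow> real) \<Rightarrow> 'a \<Rightarrow> 'a" where
  "weak_gradient \<Omega> u x = (\<Sum>i\<in>Basis. weak_partial \<Omega> i u x *\<^sub>R i)"

definition weak_laplacian :: "'a::euclidean_space set \<Rightarrow> ('a \<Rightarrow> real) \<Rightarrow> 'a \<Rightarrow> real" where
  "weak_laplacian \<Omega> u x = (\<Sum>i\<in>Basis. weak_partial \<Omega> i (weak_partial \<Omega> i u) x)"

text \<open>The Sobolev space \<open>H\<^sup>k\<close>: all weak derivatives up to order \<open>k\<close> exist and are in \<open>L\<^sup>2\<close>.\<close>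

primrec H_space :: "nat \<Rightarrow> 'a::euclidean_space set \<Rightarrow> ('a \<Rightarrow> real) set" where
  "H_space 0 \<Omega> = L2_space \<Omega>"
| "H_space (Suc k) \<Omega> =
     {u \<in> L2_space \<Omega>. \<forall>i\<in>Basis. \<exists>w\<in>H_space k \<Omega>. has_weak_partial \<Omega> i u w}"

definition H1_norm :: "'a::euclidean_space set \<Rightarrow> ('a \<Rightarrow> real) \<Rightarrow> real" where
  "H1_norm \<Omega> u = sqrt ((LINT x|lebesgue_on \<Omega>. (u x)\<^sup>2)
                      + (LINT x|lebesgue_on \<Omega>. (norm (weak_gradient \<Omega> u x))\<^sup>2))"

text \<open>\<open>H\<^sup>1\<^sub>0\<close> is the closure of the test functions in \<open>H\<^sup>1\<close>.\<close>

definition H10_space :: "'a::euclidean_space set \<Rightarrow> ('a \<Rightarrow> real) set" where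
  "H10_space \<Omega> = {u \<in> H_space 1 \<Omega>.
     \<forall>\<epsilon>>0. \<exists>\<psi>\<in>test_functions \<Omega>. H1_norm \<Omega> (\<lambda>x. u x - \<psi> x) < \<epsilon>}"

abbreviation B1 :: "'a::euclidean_space set" where
  "B1 \<equiv> ball 0 1"

definition K_ob :: "('a::euclidean_space \<Rightarrow> real) \<Rightarrow> ('a \<Rightarrow> real) set" where
  "K_ob g = {u \<in> H_space 1 B1. (\<lambda>x. u x - g x) \<in> H10_space B1 \<and> (AE x in lebesgue_on B1. u x \<ge> 0)}"

definition F_ob :: "('a::euclidean_space \<Rightarrow> real) \<Rightarrow> real" where
  "F_ob u = 1/2 * (LINT x|lebesgue_on B1. (norm (weak_gradient B1 u x))\<^sup>2)
            + (LINT x|lebesgue_on B1. u x)"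

definition grad_F_ob :: "('a::euclidean_space \<Rightarrow> real) \<Rightarrow> 'a \<Rightarrow> real" where
  "grad_F_ob u x = - weak_laplacian B1 u x + 1"

text \<open>The supremum is taken in the extended reals, so that no boundedness has to be presupposed.
  The condition \<open>v \<noteq> u\<close> is understood as inequality of classes modulo null sets.\<close>

definition slope_ob :: "('a::euclidean_space \<Rightarrow> real) \<Rightarrow> ('a \<Rightarrow> real) \<Rightarrow> ereal" where
  "slope_ob g u = max 0
     (SUP v \<in> {v \<in> K_ob g. \<not> (AE x in lebesgue_on B1. v x = u x)}.
        ereal (- (LINT x|lebesgue_on B1. (v x - u x) * grad_F_ob u x)
               / L2_norm B1 (\<lambda>x. v x - u x)))"

end

theory Submission
  imports Defs
begin

text \<open>
  Let \<open>w = \<phi> - u\<close>.  Both functions have the boundary values of \<open>g\<close>, so \<open>w\<close> is in \<open>H\<^sup>1\<^sub>0\<close>.  The energy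
  is a quadratic functional, and since \<open>u\<close> is in \<open>H\<^sup>2\<close>, integration by parts gives the exact
  identity (\<open>F_ob_expansion\<close>)
  \<open>F(u) - F(\<phi>) = - (\<integral> w * (- \<Delta>u + 1)) - 1/2 * (\<integral> (norm \<nabla>w)\<^sup>2)\<close>.
  Because \<open>\<phi>\<close> is itself a competitor in the definition of the slope \<open>S\<close>, the first term is at most
  \<open>S * norm w\<close> in the \<open>L\<^sup>2\<close> norm.  The Poincare inequality \<open>norm w \<le> 2 * t\<close> (\<open>Poincare_H10\<close>), where \<open>t\<close>
  is the \<open>L\<^sup>2\<close> norm of one partial derivative of \<open>w\<close>, bounds the gap by \<open>2 * S * t - t\<^sup>2 / 2\<close>, which
  is at most \<open>2 * S\<^sup>2\<close> for every \<open>t\<close>.  Hence the constant \<open>2\<close> works in every dimension.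

  Integration by parts and the Poincare inequality are extended from test functions to \<open>H\<^sup>1\<^sub>0\<close>
  by density (\<open>H10_space_approx\<close>).  For a test function against a Sobolev function, integration by
  parts is the definition of the weak derivative.  The Poincare inequality for test functions, and
  the fact that their classical derivatives are weak derivatives, follow from the vanishing of
  \<open>\<integral> \<partial>\<^sub>i f\<close> for compactly supported \<open>f\<close> (\<open>integral_pderivative_eq_0\<close>), a consequence of translation
  invariance.  Since a weak derivative is only a chosen representative, linearity and square
  integrability rest on its uniqueness up to null sets, that is, on the fundamental lemma of the
  calculus of variations.
\<close>

section \<open>Calculus of \<open>C\<^sup>k\<close> functions\<close>

lemma has_derivative_pderivative:
  "(f has_derivative f') (at x) \<Longrightarrow> pderivative i f x = f' i"
  unfolding pderivative_def by (metis frechet_derivative_at)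

lemma Ck_Suc_imp_Ck: "Ck (Suc k) f \<Longrightarrow> Ck k f"
proof (induction k arbitrary: f)
  case 0
  then show ?case by (auto intro: differentiable_imp_continuous_on)
next
  case (Suc k)
  then show ?case by (metis Ck.simps(2))
qed

lemma Ck_imp_continuous_on: "Ck k f \<Longrightarrow> continuous_on S f"
proof (induction k)
  case 0
  then show ?case by (auto intro: continuous_on_subset)
next
  case (Suc k)
  then show ?case by (metis Ck_Suc_imp_Ck)
qed

lemma Ck_Suc_differentiable: "Ck (Suc k) f \<Longrightarrow> f differentiable (at x)"
  by (auto simp: differentiable_on_def)

lemma Ck_Suc_has_derivative:
  "Ck (Suc k) f \<Longrightarrow> (f has_derivative frechet_derivative f (at x)) (at x)"
  using Ck_Suc_differentiable frechet_derivative_works by blast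

lemma pderivative_const: "pderivative i (\<lambda>x. c) = (\<lambda>x. 0)"
  by (rule ext, subst has_derivative_pderivative[OF has_derivative_const]) simp

lemma Ck_const [simp]: "Ck k (\<lambda>x. c)"
  by (induction k arbitrary: c) (auto simp: pderivative_const)

lemma pderivative_add:
  assumes "Ck (Suc k) f" "Ck (Suc l) h"
  shows "pderivative i (\<lambda>x. f x + h x) = (\<lambda>x. pderivative i f x + pderivative i h x)"
  using has_derivative_add[OF Ck_Suc_has_derivative[OF assms(1)] Ck_Suc_has_derivative[OF assms(2)]]
  by (auto simp: pderivative_def dest!: has_derivative_pderivative)

lemma pderivative_mult:
  assumes "Ck (Suc k) f" "Ck (Suc l) h"
  shows "pderivative i (\<lambda>x. f x * h x) = (\<lambda>x. f x * pderivative i h x + pderivative i f x * h x)"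
proof
  fix x
  show "pderivative i (\<lambda>x. f x * h x) x = f x * pderivative i h x + pderivative i f x * h x"
    using has_derivative_mult[OF Ck_Suc_has_derivative[OF assms(1)] Ck_Suc_has_derivative[OF assms(2)], of x]
    by (simp add: pderivative_def[of _ f] pderivative_def[of _ h] has_derivative_pderivative)
qed

lemma Ck_add: "Ck k f \<Longrightarrow> Ck k h \<Longrightarrow> Ck k (\<lambda>x. f x + h x)"
proof (induction k arbitrary: f h)
  case 0
  then show ?case by (auto intro: continuous_intros)
next
  case (Suc k)
  then show ?case
    using pderivative_add[OF Suc.prems] by (auto intro: differentiable_on_add)
qed

lemma Ck_mult: "Ck k f \<Longrightarrow> Ck k h \<Longrightarrow> Ck k (\<lambda>x. f x * h x)"
proof (induction k arbitrary: f h)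
  case 0
  then show ?case by (auto intro: continuous_intros)
next
  case (Suc k)
  have "Ck k f" "Ck k h" using Suc.prems Ck_Suc_imp_Ck by blast+
  then show ?case
    using Suc pderivative_mult[OF Suc.prems] 
    by (auto intro!: Ck_add differentiable_on_mult)
qed

lemma Ck_prod: "finite I \<Longrightarrow> (\<And>j. j \<in> I \<Longrightarrow> Ck k (f j)) \<Longrightarrow> Ck k (\<lambda>x. \<Prod>j\<in>I. f j x)"
  by (induction I rule: finite_induct) (auto intro: Ck_mult)

lemma Ck_cmult: "Ck k f \<Longrightarrow> Ck k (\<lambda>x. c * f x)"
  by (intro Ck_mult Ck_const)

lemma Ck_diff: "Ck k f \<Longrightarrow> Ck k h \<Longrightarrow> Ck k (\<lambda>x. f x - h x)"
  using Ck_add[OF _ Ck_cmult[of k h "-1"], of f] by simp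

lemma has_derivative_affine: "((\<lambda>x. x \<bullet> i + c) has_derivative (\<lambda>h. h \<bullet> i)) (at x)"
  by (auto intro!: derivative_eq_intros)

lemma pderivative_inner: "pderivative j (\<lambda>x. x \<bullet> i) = (\<lambda>x. j \<bullet> i)"
  by (rule ext, subst has_derivative_pderivative[OF has_derivative_affine[of i 0, simplified]]) simp

lemma Ck_inner: "Ck k (\<lambda>x. x \<bullet> i)"
proof (cases k)
  case (Suc n)
  then show ?thesis
    by (simp add: pderivative_inner differentiable_on_def differentiableI[OF has_derivative_affine[of i 0], simplified] differentiable_at_withinI)
qed (auto intro: continuous_intros)

section \<open>A smooth function that vanishes on a half-line\<close>

text \<open>With exponent \<open>m = 0\<close> this is the classical function \<open>exp (- 1 / t)\<close>.  The factor
  \<open>(1/t) ^ m\<close> makes the family closed under differentiation up to linear combinations, which turns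
  smoothness into a plain induction.\<close>

definition flat :: "nat \<Rightarrow> real \<Rightarrow> real" where
  "flat m t = (if t > 0 then (1/t) ^ m * exp (- (1/t)) else 0)"

text \<open>The exponential beats every power of \<open>1/t\<close>.  For exponent \<open>m + 1\<close> this says that the
  difference quotient of \<open>flat m\<close> at the origin tends to zero from the right.\<close>
lemma flat_over_t_tendsto_0: "((\<lambda>t. (1/t) ^ m * exp (- (1/t))) \<longlongrightarrow> (0::real)) (at_right 0)"
proof -
  have "((\<lambda>t. (inverse t) ^ m / exp (inverse t)) \<longlongrightarrow> (0::real)) (at_right 0)"
    by (rule filterlim_compose[OF tendsto_power_div_exp_0 filterlim_inverse_at_top_right])
  then show ?thesis by (simp add: exp_minus inverse_eq_divide)
qed

lemma flat_has_derivative: "(flat m has_real_derivative flat (m+2) t - m * flat (m+1) t) (at t)"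
proof (cases t "0::real" rule: linorder_cases)
  case less
  have "eventually (\<lambda>s. s < 0) (nhds t)"
    using eventually_nhds_in_open[of "{..<0}" t] less by simp
  then have "eventually (\<lambda>s. flat m s = 0) (nhds t)" by (rule eventually_mono) (auto simp: flat_def)
  then have "(flat m has_real_derivative 0) (at t)" by (subst DERIV_cong_ev[OF refl _ refl]) auto
  then show ?thesis using less by (simp add: flat_def)
next
  case equal
  have "((\<lambda>h. (flat m (0 + h) - flat m 0) / h) \<longlongrightarrow> 0) (at_right 0)"
    by (rule tendsto_cong[THEN iffD1, OF _ flat_over_t_tendsto_0[of "Suc m"]])
       (auto simp: eventually_at_filter flat_def)
  moreover have "((\<lambda>h. (flat m (0 + h) - flat m 0) / h) \<longlongrightarrow> 0) (at_left 0)"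
    by (rule tendsto_cong[THEN iffD1, OF _ tendsto_const[of 0]])
       (auto simp: eventually_at_filter flat_def)
  ultimately have "((\<lambda>h. (flat m (0 + h) - flat m 0) / h) \<longlongrightarrow> 0) (at 0)"
    by (simp add: filterlim_at_split)
  then show ?thesis using equal by (simp add: DERIV_def flat_def)
next
  case greater
  have ev: "eventually (\<lambda>s. flat m s = (1/s) ^ m * exp (- (1/s))) (nhds t)"
    using eventually_nhds_in_open[of "{0<..}" t] greater by (auto elim!: eventually_mono simp: flat_def)
  have "((\<lambda>s. (1/s) ^ m * exp (- (1/s))) has_real_derivative flat (m+2) t - m * flat (m+1) t) (at t)"
  proof -
    define r where "r = 1 / t"
    have r: "((\<lambda>s. 1 / s) has_real_derivative - (r * r)) (at t)"
      using greater by (auto intro!: derivative_eq_intros simp: r_def field_simps)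
    have p: "((\<lambda>s. (1 / s) ^ m) has_real_derivative - (m * r ^ (m + 1))) (at t)"
      using DERIV_power[OF r, of m] by (cases m) (simp_all add: r_def algebra_simps)
    have "((\<lambda>s. exp (- (1 / s))) has_real_derivative exp (- r) * (r * r)) (at t)"
      using DERIV_fun_exp[OF DERIV_minus[OF r]] by (simp add: r_def)
    from DERIV_mult[OF p this] show ?thesis
      using greater by (simp add: flat_def r_def[symmetric] algebra_simps)
  qed
  then show ?thesis using DERIV_cong_ev[OF refl ev refl] by blast
qed

lemma flat_ray_has_derivative:
  "((\<lambda>x. flat m (c * (x \<bullet> i) + e)) has_derivative
    (\<lambda>h. (flat (m+2) (c * (x \<bullet> i) + e) - m * flat (m+1) (c * (x \<bullet> i) + e)) * (c * (h \<bullet> i)))) (at x)"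
proof -
  have "((\<lambda>x. c * (x \<bullet> i) + e) has_derivative (\<lambda>h. c * (h \<bullet> i))) (at x)"
    by (auto intro!: derivative_eq_intros)
  from has_derivative_compose[OF this flat_has_derivative[of m, THEN has_field_derivative_imp_has_derivative]]
  show ?thesis by simp
qed

lemma Ck_flat: "Ck k (\<lambda>x. flat m (c * (x \<bullet> i) + e))"
proof (induction k arbitrary: m)
  case 0
  show ?case
    by (simp add: continuous_on_eq_continuous_at has_derivative_continuous[OF flat_ray_has_derivative])
next
  case (Suc k)
  have "pderivative j (\<lambda>x. flat m (c * (x \<bullet> i) + e)) =
    (\<lambda>x. (c * (j \<bullet> i)) * (flat (m+2) (c * (x \<bullet> i) + e) - m * flat (m+1) (c * (x \<bullet> i) + e)))" for j
    by (rule ext, subst has_derivative_pderivative[OF flat_ray_has_derivative]) simp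
  then show ?case
    using Suc by (auto simp: differentiable_on_def intro!: Ck_cmult Ck_diff differentiable_at_withinI
        differentiableI[OF flat_ray_has_derivative])
qed

section \<open>Integration by parts for compactly supported functions\<close>

lemma continuous_on_pderivative: "Ck (Suc k) f \<Longrightarrow> i \<in> Basis \<Longrightarrow> continuous_on S (pderivative i f)"
  by (auto intro: Ck_imp_continuous_on)

lemma Ck_imp_borel_measurable: "Ck k f \<Longrightarrow> f \<in> borel_measurable borel"
  by (rule borel_measurable_continuous_onI[OF Ck_imp_continuous_on])

lemma pderivative_eq_0_outside_closed:
  assumes "closed K" "\<And>x. x \<notin> K \<Longrightarrow> f x = 0" "x \<notin> K"
  shows "pderivative i f x = 0"
proof -
  have "(f has_derivative (\<lambda>h. 0)) (at x)"
    by (rule has_derivative_transform_within_open[OF has_derivative_const[of 0], of "- K"])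
       (use assms in auto)
  then show ?thesis by (rule has_derivative_pderivative)
qed

lemma integrable_compact_support:
  fixes f :: "'a::euclidean_space \<Rightarrow> real"
  assumes "continuous_on UNIV f" "compact K" "\<And>x. x \<notin> K \<Longrightarrow> f x = 0"
  shows "integrable lborel f"
proof -
  have "integrable lborel (\<lambda>x. indicator K x *\<^sub>R f x)"
    by (rule borel_integrable_compact[OF assms(2)]) (use assms in \<open>auto intro: continuous_on_subset\<close>)
  also have "(\<lambda>x. indicator K x *\<^sub>R f x) = f"
    using assms(3) by (auto simp: fun_eq_iff split: split_indicator)
  finally show ?thesis .
qed

lemma bounded_compact_support:
  fixes f :: "'a::euclidean_space \<Rightarrow> real"
  assumes "continuous_on UNIV f" "compact K" "\<And>x. x \<notin> K \<Longrightarrow> f x = 0"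
  obtains B where "0 \<le> B" "\<And>x. \<bar>f x\<bar> \<le> B"
proof -
  have "bounded (f ` K)"
    by (intro compact_imp_bounded compact_continuous_image continuous_on_subset[OF assms(1)] assms) auto
  then obtain B where "\<And>x. x \<in> K \<Longrightarrow> \<bar>f x\<bar> \<le> B" "0 < B"
    by (auto simp: bounded_pos)
  then show ?thesis using that[of B] assms(3) by (metis abs_zero less_imp_le)
qed

lemma line_has_real_derivative:
  assumes "Ck (Suc k) f"
  shows "((\<lambda>t. f (x + t *\<^sub>R i)) has_real_derivative pderivative i f (x + t *\<^sub>R i)) (at t)"
proof -
  let ?D = "frechet_derivative f (at (x + t *\<^sub>R i))"
  have D: "(f has_derivative ?D) (at (x + t *\<^sub>R i))"
    using assms by (rule Ck_Suc_has_derivative)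
  have "((\<lambda>t. x + t *\<^sub>R i) has_derivative (\<lambda>h. h *\<^sub>R i)) (at t)"
    by (auto intro!: derivative_eq_intros)
  from has_derivative_compose[OF this D]
  have "((\<lambda>t. f (x + t *\<^sub>R i)) has_derivative (\<lambda>h. ?D (h *\<^sub>R i))) (at t)" .
  also have "(\<lambda>h. ?D (h *\<^sub>R i)) = (*) (pderivative i f (x + t *\<^sub>R i))"
    using linear_scale[OF has_derivative_linear[OF D]] by (auto simp: pderivative_def)
  finally show ?thesis by (simp add: has_field_derivative_def)
qed

text \<open>Translation invariance of Lebesgue measure gives every difference quotient of \<open>f\<close> along \<open>i\<close>
  the integral zero.  By the mean value theorem these quotients are bounded by the supremum of
  the partial derivative, and they vanish outside a common ball, so dominated convergence
  passes the identity to the derivative itself.\<close>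
lemma integral_pderivative_eq_0:
  fixes f :: "'a::euclidean_space \<Rightarrow> real"
  assumes f: "Ck (Suc k) f" and K: "compact K" and supp: "\<And>x. x \<notin> K \<Longrightarrow> f x = 0"
    and i: "i \<in> Basis"
  shows "(\<integral>x. pderivative i f x \<partial>lborel) = 0"
proof -
  define g where "g = pderivative i f"
  have g_cont: "continuous_on UNIV g" unfolding g_def using continuous_on_pderivative[OF f i] .
  have g0: "g x = 0" if "x \<notin> K" for x
    unfolding g_def using pderivative_eq_0_outside_closed[OF compact_imp_closed[OF K] supp that] .
  obtain B where B: "0 \<le> B" "\<And>x. \<bar>g x\<bar> \<le> B" using bounded_compact_support[OF g_cont K g0] by blast
  obtain R where R: "\<And>x. x \<in> K \<Longrightarrow> norm x \<le> R"
    using compact_imp_bounded[OF K] by (auto simp: bounded_iff)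
  have f_cont: "continuous_on UNIV f" using f by (rule Ck_imp_continuous_on)
  have f_int: "integrable lborel f" by (rule integrable_compact_support[OF f_cont K supp])
  have f_meas [measurable]: "f \<in> borel_measurable borel"
    by (rule borel_measurable_continuous_onI[OF f_cont])
  have g_meas [measurable]: "g \<in> borel_measurable borel"
    by (rule borel_measurable_continuous_onI[OF g_cont])
  define q where "q n x = (f (x + (1 / real (Suc n)) *\<^sub>R i) - f x) * real (Suc n)" for n x
  have shift_int: "integrable lborel (\<lambda>x. f (x + c))" 
   and shift_eq: "(\<integral>x. f (x + c) \<partial>lborel) = (\<integral>x. f x \<partial>lborel)" for c
  proof -
    show "(\<integral>x. f (x + c) \<partial>lborel) = (\<integral>x. f x \<partial>lborel)"
      using integral_distr[of "(+) c" lborel borel f] by (simp add: lborel_distr_plus add.commute)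
    show "integrable lborel (\<lambda>x. f (x + c))"
      using integrable_distr_eq[of "(+) c" lborel borel f] f_int by (simp add: lborel_distr_plus add.commute)
  qed
  have q_int: "(\<integral>x. q n x \<partial>lborel) = 0" for n
    unfolding q_def using shift_int shift_eq f_int by simp
  have q_lim: "(\<lambda>n. q n x) \<longlonglongrightarrow> g x" for x
  proof -
    have "((\<lambda>h. (f (x + h *\<^sub>R i) - f x) / h) \<longlongrightarrow> g x) (at 0)"
      using line_has_real_derivative[OF f, of x i 0] by (simp add: DERIV_def g_def)
    moreover have "filterlim (\<lambda>n. 1 / real (Suc n)) (at 0) sequentially"
      unfolding filterlim_at using LIMSEQ_Suc[OF lim_1_over_n] by auto
    ultimately have "(\<lambda>n. (f (x + (1 / real (Suc n)) *\<^sub>R i) - f x) / (1 / real (Suc n))) \<longlonglongrightarrow> g x"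
      by (rule filterlim_compose)
    then show ?thesis by (simp add: q_def)
  qed
  \<comment> \<open>Steps have length at most one, so enlarging the ball by one contains the support of every quotient.\<close>
  have q_bound: "\<bar>q n x\<bar> \<le> indicator (cball 0 (R + 1)) x *\<^sub>R B" for n x
  proof (cases "x \<in> cball 0 (R + 1)")
    case True
    obtain t where t: "f (x + (1 / real (Suc n)) *\<^sub>R i) - f x = (1 / real (Suc n)) * g (x + t *\<^sub>R i)"
      using MVT2[of 0 "1 / real (Suc n)" "\<lambda>t. f (x + t *\<^sub>R i)" "\<lambda>t. g (x + t *\<^sub>R i)"]
        line_has_real_derivative[OF f, of x i] by (auto simp: g_def)
    have "q n x = g (x + t *\<^sub>R i)" unfolding q_def t by (simp del: of_nat_Suc)
    then show ?thesis using True B by simp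
  next
    case False
    then have n1: "norm x > R + 1" by simp
    have "norm x \<le> norm (x + (1 / real (Suc n)) *\<^sub>R i) + norm ((1 / real (Suc n)) *\<^sub>R i)"
      by (metis add_diff_cancel_right' norm_triangle_ineq4)
    also have "norm ((1 / real (Suc n)) *\<^sub>R i) \<le> 1" using i by simp
    finally have "f (x + (1 / real (Suc n)) *\<^sub>R i) = 0" using n1 R supp by fastforce
    moreover have "f x = 0" using n1 R supp by fastforce
    ultimately show ?thesis using False by (simp add: q_def)
  qed
  have "(\<lambda>n. \<integral>x. q n x \<partial>lborel) \<longlonglongrightarrow> (\<integral>x. g x \<partial>lborel)"
  proof (rule integral_dominated_convergence)
    show "integrable lborel (\<lambda>x. indicator (cball (0::'a) (R + 1)) x *\<^sub>R B)"
      by (rule borel_integrable_compact) auto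
    show "q n \<in> borel_measurable lborel" for n unfolding q_def by measurable
  qed (use q_lim q_bound in auto)
  then show ?thesis unfolding q_int g_def[symmetric] by (simp add: LIMSEQ_const_iff)
qed

lemma integral_lebesgue_on_eq_lborel:
  fixes f :: "'a::euclidean_space \<Rightarrow> real"
  assumes "\<Omega> \<in> sets lebesgue" "f \<in> borel_measurable borel" "\<And>x. x \<notin> \<Omega> \<Longrightarrow> f x = 0"
  shows "(LINT x|lebesgue_on \<Omega>. f x) = (\<integral>x. f x \<partial>lborel)"
proof -
  have eq: "(\<lambda>x. indicator \<Omega> x *\<^sub>R f x) = f" using assms(3) by (auto simp: fun_eq_iff split: split_indicator)
  show "(LINT x|lebesgue_on \<Omega>. f x) = (\<integral>x. f x \<partial>lborel)"
    using assms by (simp add: integral_restrict_space eq[simplified] integral_completion)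
qed

lemma test_functions_compact_support:
  assumes "\<psi> \<in> test_functions \<Omega>"
  shows "\<exists>K. compact K \<and> K \<subseteq> \<Omega> \<and> (\<forall>x. x \<notin> K \<longrightarrow> \<psi> x = 0)"
  using assms closure_subset[of "{x. \<psi> x \<noteq> 0}"]
  by (intro exI[of _ "closure {x. \<psi> x \<noteq> 0}"]) (auto simp: test_functions_def)

lemma test_functionsI:
  assumes "\<And>k. Ck k \<psi>" "compact K" "K \<subseteq> \<Omega>" "\<And>x. x \<notin> K \<Longrightarrow> \<psi> x = 0"
  shows "\<psi> \<in> test_functions \<Omega>"
proof -
  have sub: "closure {x. \<psi> x \<noteq> 0} \<subseteq> K"
    by (rule closure_minimal) (use assms compact_imp_closed in auto)
  then have "compact (closure {x. \<psi> x \<noteq> 0})"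
    using closed_Int_compact[OF closed_closure assms(2)] by (metis inf.absorb1)
  with sub show ?thesis using assms(1,3) by (auto simp: test_functions_def)
qed

lemma test_functions_Ck: "\<psi> \<in> test_functions \<Omega> \<Longrightarrow> Ck k \<psi>"
  by (simp add: test_functions_def)

lemma test_functions_diff:
  assumes "\<psi> \<in> test_functions \<Omega>" "\<eta> \<in> test_functions \<Omega>"
  shows "(\<lambda>x. \<psi> x - \<eta> x) \<in> test_functions \<Omega>"
proof -
  obtain K where K: "compact K" "K \<subseteq> \<Omega>" "\<And>x. x \<notin> K \<Longrightarrow> \<psi> x = 0"
    using test_functions_compact_support[OF assms(1)] by blast
  obtain L where L: "compact L" "L \<subseteq> \<Omega>" "\<And>x. x \<notin> L \<Longrightarrow> \<eta> x = 0"
    using test_functions_compact_support[OF assms(2)] by blast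
  show ?thesis
  proof (rule test_functionsI)
    show "Ck k (\<lambda>x. \<psi> x - \<eta> x)" for k
      by (intro Ck_diff assms[THEN test_functions_Ck])
    show "compact (K \<union> L)" "K \<union> L \<subseteq> \<Omega>" using K L by auto
    show "\<psi> x - \<eta> x = 0" if "x \<notin> K \<union> L" for x using K(3) L(3) that by simp
  qed
qed

lemma continuous_imp_locally_integrable:
  fixes f :: "'a::euclidean_space \<Rightarrow> real"
  assumes "continuous_on UNIV f"
  shows "locally_integrable \<Omega> f"
  unfolding locally_integrable_def
proof (intro allI impI)
  fix K :: "'a set" assume K: "compact K \<and> K \<subseteq> \<Omega>"
  have [measurable]: "f \<in> borel_measurable borel" "K \<in> sets borel"
    using assms K by (auto intro: borel_measurable_continuous_onI borel_compact)
  have "integrable lborel (\<lambda>x. indicator K x *\<^sub>R f x)"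
    using K assms by (intro borel_integrable_compact) (auto intro: continuous_on_subset)
  then have "integrable lebesgue (\<lambda>x. indicator K x *\<^sub>R f x)"
    by (subst integrable_completion) simp_all
  then show "integrable (lebesgue_on K) f"
    by (subst integrable_restrict_space) auto
qed

text \<open>The product of two test functions has compact support, so its partial derivative
  integrates to zero; this is the product rule under the integral.\<close>
lemma test_function_has_weak_partial:
  fixes \<psi> :: "'a::euclidean_space \<Rightarrow> real"
  assumes \<psi>: "\<psi> \<in> test_functions \<Omega>" and \<Omega>: "open \<Omega>" and i: "i \<in> Basis"
  shows "has_weak_partial \<Omega> i \<psi> (pderivative i \<psi>)"
  unfolding has_weak_partial_def
proof (intro conjI ballI)
  show "locally_integrable \<Omega> \<psi>" "locally_integrable \<Omega> (pderivative i \<psi>)"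
    using test_functions_Ck[OF \<psi>] continuous_on_pderivative[OF _ i]
    by (blast intro: continuous_imp_locally_integrable Ck_imp_continuous_on)+
next
  fix \<eta> assume \<eta>: "\<eta> \<in> test_functions \<Omega>"
  have L: "\<Omega> \<in> sets lebesgue" using \<Omega> by auto
  obtain K where K: "compact K" "K \<subseteq> \<Omega>" "\<And>x. x \<notin> K \<Longrightarrow> \<psi> x = 0"
    using test_functions_compact_support[OF \<psi>] by blast
  have K': "pderivative i \<psi> x = 0" if "x \<notin> K" for x
    using pderivative_eq_0_outside_closed[OF compact_imp_closed[OF K(1)] K(3) that] .
  have C: "Ck (Suc 0) \<psi>" "Ck (Suc 0) \<eta>" using \<psi> \<eta> test_functions_Ck by blast+
  have cont: "continuous_on UNIV \<psi>" "continuous_on UNIV \<eta>"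
    "continuous_on UNIV (pderivative i \<psi>)" "continuous_on UNIV (pderivative i \<eta>)"
    using C i by (blast intro: Ck_imp_continuous_on continuous_on_pderivative)+
  note [measurable] = cont[THEN borel_measurable_continuous_onI]
  have int: "integrable lborel (\<lambda>x. \<psi> x * pderivative i \<eta> x)"
    "integrable lborel (\<lambda>x. pderivative i \<psi> x * \<eta> x)"
    by (rule integrable_compact_support[OF _ K(1)]; (intro continuous_intros cont)?; simp add: K K')+
  have "0 = (\<integral>x. pderivative i (\<lambda>x. \<psi> x * \<eta> x) x \<partial>lborel)"
    by (rule integral_pderivative_eq_0[symmetric, OF Ck_mult[OF C] K(1) _ i]) (simp add: K)
  also have "\<dots> = (\<integral>x. \<psi> x * pderivative i \<eta> x \<partial>lborel) + (\<integral>x. pderivative i \<psi> x * \<eta> x \<partial>lborel)"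
    unfolding pderivative_mult[OF C] using int by simp
  finally show "(LINT x|lebesgue_on \<Omega>. \<psi> x * pderivative i \<eta> x) = - (LINT x|lebesgue_on \<Omega>. pderivative i \<psi> x * \<eta> x)"
    using K(2) K(3) K' by (subst (1 2) integral_lebesgue_on_eq_lborel[OF L]) auto
qed

text \<open>Integrating the derivative of \<open>(x \<bullet> i) * (\<psi> x)\<^sup>2\<close> expresses the integral of \<open>\<psi>\<^sup>2\<close> by the
  integral of \<open>- 2 * (x \<bullet> i) * \<psi> * \<partial>\<^sub>i\<psi>\<close>.  Since \<open>\<bar>x \<bullet> i\<bar> \<le> 1\<close> on the unit ball, Young's
  inequality absorbs half of the left-hand side, and the constant does not even depend on the
  dimension.\<close>
lemma Poincare_test_function:
  fixes \<psi> :: "'a::euclidean_space \<Rightarrow> real"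
  assumes \<psi>: "\<psi> \<in> test_functions B1" and i: "i \<in> Basis"
  shows "(LINT x|lebesgue_on B1. (\<psi> x)\<^sup>2) \<le> 4 * (LINT x|lebesgue_on B1. (pderivative i \<psi> x)\<^sup>2)"
proof -
  have L: "(B1 :: 'a set) \<in> sets lebesgue" by auto
  obtain K where K: "compact K" "K \<subseteq> B1" "\<And>x. x \<notin> K \<Longrightarrow> \<psi> x = 0"
    using test_functions_compact_support[OF \<psi>] by blast
  have K': "pderivative i \<psi> x = 0" if "x \<notin> K" for x
    using pderivative_eq_0_outside_closed[OF compact_imp_closed[OF K(1)] K(3) that] .
  have C: "Ck (Suc 0) \<psi>" using \<psi> test_functions_Ck by blast
  have C2: "Ck (Suc 0) (\<lambda>x. \<psi> x * \<psi> x)" by (rule Ck_mult[OF C C])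
  have C3: "Ck (Suc 0) (\<lambda>x. (x \<bullet> i) * (\<psi> x * \<psi> x))" by (rule Ck_mult[OF Ck_inner C2])
  have cont: "continuous_on UNIV \<psi>" "continuous_on UNIV (pderivative i \<psi>)"
    using C i by (blast intro: Ck_imp_continuous_on continuous_on_pderivative)+
  note [measurable] = cont[THEN borel_measurable_continuous_onI]
  have int: "integrable lborel (\<lambda>x. (\<psi> x)\<^sup>2)" "integrable lborel (\<lambda>x. (pderivative i \<psi> x)\<^sup>2)"
    "integrable lborel (\<lambda>x. 2 * (x \<bullet> i) * \<psi> x * pderivative i \<psi> x)"
    by (rule integrable_compact_support[OF _ K(1)]; (intro continuous_intros cont)?; simp add: K K')+
  have "0 = (\<integral>x. pderivative i (\<lambda>x. (x \<bullet> i) * (\<psi> x * \<psi> x)) x \<partial>lborel)"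
    by (rule integral_pderivative_eq_0[symmetric, OF C3 K(1) _ i]) (simp add: K)
  also have "pderivative i (\<lambda>x. (x \<bullet> i) * (\<psi> x * \<psi> x)) =
      (\<lambda>x. (\<psi> x)\<^sup>2 + 2 * (x \<bullet> i) * \<psi> x * pderivative i \<psi> x)"
    unfolding pderivative_mult[OF Ck_inner[of "Suc 0"] C2] pderivative_mult[OF C C] pderivative_inner
    using i by (auto simp: power2_eq_square algebra_simps)
  finally have eq: "(\<integral>x. (\<psi> x)\<^sup>2 \<partial>lborel) = (\<integral>x. - (2 * (x \<bullet> i) * \<psi> x * pderivative i \<psi> x) \<partial>lborel)"
    using int by simp
  also have "\<dots> \<le> (\<integral>x. 1/2 * (\<psi> x)\<^sup>2 + 2 * (pderivative i \<psi> x)\<^sup>2 \<partial>lborel)"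
  proof (rule integral_mono)
    fix x
    show "- (2 * (x \<bullet> i) * \<psi> x * pderivative i \<psi> x) \<le> 1/2 * (\<psi> x)\<^sup>2 + 2 * (pderivative i \<psi> x)\<^sup>2"
    proof (cases "x \<in> K")
      case True
      then have "norm x < 1" using K(2) by auto
      then have "\<bar>x \<bullet> i\<bar> \<le> 1" using Basis_le_norm[OF i, of x] by linarith
      then have "\<bar>2 * (x \<bullet> i) * \<psi> x * pderivative i \<psi> x\<bar> \<le> 2 * \<bar>\<psi> x\<bar> * \<bar>pderivative i \<psi> x\<bar>"
        by (simp add: abs_mult mult_left_le_one_le mult_right_mono)
      also have "\<dots> \<le> 1/2 * (\<psi> x)\<^sup>2 + 2 * (pderivative i \<psi> x)\<^sup>2"
        using zero_le_power2[of "\<bar>\<psi> x\<bar> - 2 * \<bar>pderivative i \<psi> x\<bar>"] by (simp add: power2_diff power_mult_distrib)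
      finally show ?thesis by linarith
    next
      case False then show ?thesis by (simp add: K K')
    qed
  qed (use int in auto)
  also have "\<dots> = 1/2 * (\<integral>x. (\<psi> x)\<^sup>2 \<partial>lborel) + 2 * (\<integral>x. (pderivative i \<psi> x)\<^sup>2 \<partial>lborel)"
    using int by simp
  finally have *: "(\<integral>x. (\<psi> x)\<^sup>2 \<partial>lborel) \<le> 4 * (\<integral>x. (pderivative i \<psi> x)\<^sup>2 \<partial>lborel)"
    by simp
  have "\<psi> x = 0" "pderivative i \<psi> x = 0" if "x \<notin> B1" for x
    using K(2) K(3) K' that by blast+
  with * show ?thesis
    by (subst (1 2) integral_lebesgue_on_eq_lborel[OF L]) auto
qed

section \<open>The fundamental lemma of the calculus of variations\<close>

lemma integrable_mult_compact_support:
  fixes w \<psi> :: "'a::euclidean_space \<Rightarrow> real"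
  assumes w: "locally_integrable \<Omega> w" and K: "compact K" "K \<subseteq> \<Omega>" "\<And>x. x \<notin> K \<Longrightarrow> \<psi> x = 0"
    and cont: "continuous_on UNIV \<psi>" and \<Omega>: "\<Omega> \<in> sets lebesgue"
  shows "integrable (lebesgue_on \<Omega>) (\<lambda>x. w x * \<psi> x)"
proof -
  have KL: "K \<in> sets lebesgue" using K by (simp add: borel_compact)
  have wK: "integrable lebesgue (\<lambda>x. indicator K x *\<^sub>R w x)"
    using w K KL unfolding locally_integrable_def by (subst integrable_restrict_space[symmetric]) auto
  obtain B where B: "0 \<le> B" "\<And>x. \<bar>\<psi> x\<bar> \<le> B"
    using bounded_compact_support[OF cont K(1,3)] by blast
  have "integrable lebesgue (\<lambda>x. (indicator K x *\<^sub>R w x) * \<psi> x)"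
  proof (rule Bochner_Integration.integrable_bound[OF integrable_mult_right[OF wK, of B]])
    have "\<psi> \<in> borel_measurable lebesgue"
      using borel_measurable_continuous_onI[OF cont] by (simp add: measurable_completion)
    then show "(\<lambda>x. (indicator K x *\<^sub>R w x) * \<psi> x) \<in> borel_measurable lebesgue"
      using borel_measurable_integrable[OF wK] by measurable
    show "AE x in lebesgue. norm ((indicator K x *\<^sub>R w x) * \<psi> x) \<le> norm (B * (indicator K x *\<^sub>R w x))"
      using B by (auto simp: abs_mult mult.commute[of B] intro!: mult_left_mono AE_I2 split: split_indicator)
  qed
  also have "(\<lambda>x. (indicator K x *\<^sub>R w x) * \<psi> x) = (\<lambda>x. indicator \<Omega> x *\<^sub>R (w x * \<psi> x))"
    using K by (auto simp: fun_eq_iff split: split_indicator)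
  finally show ?thesis using \<Omega> by (subst integrable_restrict_space) auto
qed

lemma integrable_mult_test_function:
  fixes w \<psi> :: "'a::euclidean_space \<Rightarrow> real"
  assumes "locally_integrable \<Omega> w" "\<psi> \<in> test_functions \<Omega>" "\<Omega> \<in> sets lebesgue"
  shows "integrable (lebesgue_on \<Omega>) (\<lambda>x. w x * \<psi> x)"
  using test_functions_compact_support[OF assms(2)] Ck_imp_continuous_on[OF test_functions_Ck[OF assms(2)]]
    integrable_mult_compact_support[OF assms(1) _ _ _ _ assms(3)] by blast

lemma integrable_mult_pderivative_test_function:
  fixes w \<psi> :: "'a::euclidean_space \<Rightarrow> real"
  assumes "locally_integrable \<Omega> w" "\<psi> \<in> test_functions \<Omega>" "i \<in> Basis" "\<Omega> \<in> sets lebesgue"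
  shows "integrable (lebesgue_on \<Omega>) (\<lambda>x. w x * pderivative i \<psi> x)"
proof -
  obtain K where K: "compact K" "K \<subseteq> \<Omega>" "\<And>x. x \<notin> K \<Longrightarrow> \<psi> x = 0"
    using test_functions_compact_support[OF assms(2)] by blast
  show ?thesis
    by (rule integrable_mult_compact_support[OF assms(1) K(1,2)
          pderivative_eq_0_outside_closed[OF compact_imp_closed[OF K(1)] K(3)]
          continuous_on_pderivative[OF test_functions_Ck[OF assms(2)] assms(3)] assms(4)])
qed

text \<open>A smooth approximation of the indicator of \<open>box a b\<close>: as the parameter \<open>c\<close> grows, each
  factor increases to the indicator of an open half-space bounded by a face of the box.\<close>
definition box_bump :: "'a::euclidean_space \<Rightarrow> 'a \<Rightarrow> real \<Rightarrow> 'a \<Rightarrow> real" where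
  "box_bump a b c x = (\<Prod>i\<in>Basis. flat 0 (c * (x \<bullet> i) + - c * (a \<bullet> i)) * flat 0 (- c * (x \<bullet> i) + c * (b \<bullet> i)))"

lemma flat0_bounds: "0 \<le> flat 0 t" "flat 0 t \<le> 1"
  by (auto simp: flat_def)

lemma Ck_box_bump: "Ck k (box_bump a b c)"
  unfolding box_bump_def by (intro Ck_prod Ck_mult Ck_flat) auto

lemma box_bump_bounds: "0 \<le> box_bump a b c x" "box_bump a b c x \<le> 1"
  unfolding box_bump_def
  by (auto intro!: prod_nonneg prod_le_1 mult_nonneg_nonneg mult_le_one flat0_bounds)

lemma box_bump_outside: "c > 0 \<Longrightarrow> x \<notin> box a b \<Longrightarrow> box_bump a b c x = 0"
proof -
  assume c: "c > 0" and "x \<notin> box a b"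
  then obtain i where i: "i \<in> Basis" "x \<bullet> i \<le> a \<bullet> i \<or> b \<bullet> i \<le> x \<bullet> i"
    by (auto simp: mem_box not_less)
  then have "flat 0 (c * (x \<bullet> i) + - c * (a \<bullet> i)) * flat 0 (- c * (x \<bullet> i) + c * (b \<bullet> i)) = 0"
    using c by (auto simp: flat_def)
  with i show ?thesis unfolding box_bump_def by (intro prod_zero) auto
qed

lemma flat0_tendsto_1: "s > 0 \<Longrightarrow> (\<lambda>n. flat 0 (real (Suc n) * s)) \<longlonglongrightarrow> 1"
proof -
  assume s: "s > 0"
  have "(\<lambda>n. exp (- ((1 / real (Suc n)) * (1 / s)))) \<longlonglongrightarrow> exp (- (0 * (1 / s)))"
    by (intro tendsto_intros LIMSEQ_Suc[OF lim_1_over_n])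
  then show ?thesis using s by (simp add: flat_def)
qed

lemma box_bump_tendsto:
  fixes x :: "'a::euclidean_space"
  shows "(\<lambda>n. box_bump a b (real (Suc n)) x) \<longlonglongrightarrow> indicator (box a b) x"
proof (cases "x \<in> box a b")
  case True
  have "(\<lambda>n. \<Prod>i\<in>Basis. flat 0 (real (Suc n) * (x \<bullet> i - a \<bullet> i)) * flat 0 (real (Suc n) * (b \<bullet> i - x \<bullet> i)))
     \<longlonglongrightarrow> (\<Prod>i\<in>(Basis::'a set). 1 * 1)"
  proof (intro tendsto_prod tendsto_mult flat0_tendsto_1)
    fix i :: 'a assume "i \<in> Basis"
    then show "0 < x \<bullet> i - a \<bullet> i" "0 < b \<bullet> i - x \<bullet> i" using True by (auto simp: mem_box)
  qed
  then show ?thesis using True by (simp add: box_bump_def algebra_simps)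
next
  case False
  then show ?thesis by (simp add: box_bump_outside)
qed

text \<open>The bump functions of a box are test functions, have values in \<open>[0, 1]\<close> and converge
  pointwise to its indicator, so orthogonality to test functions becomes orthogonality to
  indicators of boxes.\<close>
lemma integral_box_eq_0:
  fixes f :: "'a::euclidean_space \<Rightarrow> real"
  assumes f: "locally_integrable \<Omega> f" and \<Omega>: "\<Omega> \<in> sets lebesgue"
    and orth: "\<And>\<psi>. \<psi> \<in> test_functions \<Omega> \<Longrightarrow> (LINT x|lebesgue_on \<Omega>. f x * \<psi> x) = 0"
    and sub: "cbox a b \<subseteq> \<Omega>"
  shows "(LINT x|lebesgue. indicator (box a b) x * f x) = 0"
proof -
  have fi: "integrable lebesgue (\<lambda>x. indicator (cbox a b) x *\<^sub>R f x)"
    using f sub unfolding locally_integrable_def by (subst integrable_restrict_space[symmetric]) auto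
  define s where "s n x = (indicator (cbox a b) x *\<^sub>R f x) * box_bump a b (real (Suc n)) x" for n x
  have s_eq: "s n x = indicator \<Omega> x *\<^sub>R (f x * box_bump a b (real (Suc n)) x)" for n x
    using sub box_subset_cbox[of a b] box_bump_outside[of "real (Suc n)" x a b]
    by (auto simp: s_def split: split_indicator)
  have "box_bump a b (real (Suc n)) \<in> test_functions \<Omega>" for n
    using box_subset_cbox[of a b] by (intro test_functionsI[OF Ck_box_bump compact_cbox sub] box_bump_outside) auto
  then have s0: "(LINT x|lebesgue. s n x) = 0" for n
    unfolding s_eq using orth[of "box_bump a b (real (Suc n))"] \<Omega>
    by (subst integral_restrict_space[symmetric]) auto
  have "(\<lambda>n. LINT x|lebesgue. s n x) \<longlonglongrightarrow> (LINT x|lebesgue. indicator (box a b) x * f x)"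
  proof (rule integral_dominated_convergence[OF _ _ integrable_abs[OF fi]])
    have m: "(\<lambda>x. indicator (cbox a b) x *\<^sub>R f x) \<in> borel_measurable lebesgue"
      using fi by (rule borel_measurable_integrable)
    then have "(\<lambda>x. indicator (box a b) x * (indicator (cbox a b) x *\<^sub>R f x)) \<in> borel_measurable lebesgue"
      by (intro borel_measurable_times borel_measurable_indicator) auto
    moreover have "(\<lambda>x. indicator (box a b) x * (indicator (cbox a b) x *\<^sub>R f x)) = (\<lambda>x. indicator (box a b) x * f x)"
      using box_subset_cbox[of a b] by (auto simp: fun_eq_iff split: split_indicator)
    ultimately show "(\<lambda>x. indicator (box a b) x * f x) \<in> borel_measurable lebesgue" by simp
    have "box_bump a b (real (Suc n)) \<in> borel_measurable lebesgue" for n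
      by (rule measurable_completion) (simp add: Ck_imp_borel_measurable[OF Ck_box_bump[of 0]])
    with m show "s n \<in> borel_measurable lebesgue" for n
      unfolding s_def by measurable
    show "AE x in lebesgue. (\<lambda>n. s n x) \<longlonglongrightarrow> indicator (box a b) x * f x"
    proof (rule AE_I2)
      fix x
      have "(\<lambda>n. s n x) \<longlonglongrightarrow> (indicator (cbox a b) x *\<^sub>R f x) * indicator (box a b) x"
        unfolding s_def by (intro tendsto_intros box_bump_tendsto)
      also have "(indicator (cbox a b) x *\<^sub>R f x) * indicator (box a b) x = indicator (box a b) x * f x"
        using box_subset_cbox[of a b] by (auto split: split_indicator)
      finally show "(\<lambda>n. s n x) \<longlonglongrightarrow> indicator (box a b) x * f x" .
    qed
    show "AE x in lebesgue. norm (s n x) \<le> \<bar>indicator (cbox a b) x *\<^sub>R f x\<bar>" for n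
      unfolding s_def real_norm_def abs_mult
      by (intro AE_I2 mult_right_le_one_le) (auto simp: box_bump_bounds)
  qed
  then show ?thesis unfolding s0 by (simp add: LIMSEQ_const_iff)
qed

text \<open>Open boxes form an intersection-stable generator of the Borel sets, so the integral of \<open>f\<close>
  vanishes over every Borel set, and densities are determined by their integrals.  The
  argument takes place in \<open>lborel\<close>, for a Borel representative of \<open>f\<close>.\<close>
lemma AE_eq_0_if_box_integrals_eq_0:
  fixes f :: "'a::euclidean_space \<Rightarrow> real"
  assumes f: "integrable lebesgue f" and zero: "(LINT x|lebesgue. f x) = 0"
    and box: "\<And>c d. (LINT x|lebesgue. indicator (box c d) x * f x) = 0"
  shows "AE x in lebesgue. f x = 0"
proof -
  obtain f' where f' [measurable]: "f' \<in> borel_measurable lborel" and ae: "AE x in lborel. f x = f' x"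
    using completion_ex_borel_measurable_real[OF borel_measurable_integrable[OF f]] by blast
  have ae': "AE x in lebesgue. f x = f' x" using ae by (rule AE_completion)
  have m': "f' \<in> borel_measurable lebesgue" using f' by (simp add: measurable_completion)
  have "integrable lebesgue f'"
    using integrable_cong_AE[OF borel_measurable_integrable[OF f] m' ae'] f by simp
  then have int: "integrable lborel f'" using f' by (simp add: integrable_completion)
  have eq: "(LINT x|lborel. indicator A x * f' x) = (LINT x|lebesgue. indicator A x * f x)"
    if [measurable]: "A \<in> sets borel" for A
  proof -
    have "(LINT x|lebesgue. indicator A x * f x) = (LINT x|lebesgue. indicator A x * f' x)"
      by (rule integral_cong_AE)
         (use ae' borel_measurable_integrable[OF f] m' that in \<open>auto intro!: borel_measurable_times borel_measurable_indicator\<close>)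
    then show ?thesis by (subst integral_completion[symmetric]) auto
  qed
  have boxes: "Int_stable (range (\<lambda>(a, b). box a b :: 'a set))"
      "range (\<lambda>(a, b). box a b :: 'a set) \<subseteq> Pow UNIV"
    by (auto simp: Int_stable_def box_Int_box)
  have sets0: "(LINT x:A|lborel. f' x) = 0" if "A \<in> sigma_sets UNIV (range (\<lambda>(a, b). box a b))" for A
    using boxes that
  proof (induction rule: sigma_sets_induct_disjoint)
    case (basic A)
    then show ?case using eq box by (auto simp: set_lebesgue_integral_def)
  next
    case empty
    show ?case by (simp add: set_lebesgue_integral_def)
  next
    case (compl A)
    then have "A \<in> sets borel" unfolding borel_eq_box by simp
    then have i: "integrable lborel (\<lambda>x. indicator A x *\<^sub>R f' x)"
      by (intro integrable_mult_indicator int) auto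
    have "(LINT x:UNIV - A|lborel. f' x) = (LINT x|lborel. f' x - indicator A x *\<^sub>R f' x)"
      unfolding set_lebesgue_integral_def
      by (intro Bochner_Integration.integral_cong) (auto split: split_indicator)
    also have "\<dots> = 0"
      using int i compl eq[of UNIV] zero by (simp add: set_lebesgue_integral_def)
    finally show ?case .
  next
    case (union A)
    then have A: "A i \<in> sets lborel" for i unfolding sets_lborel borel_eq_box by auto
    then have "set_integrable lborel (\<Union>i. A i) f'"
      unfolding set_integrable_def by (intro integrable_mult_indicator int) auto
    then have "(LINT x:(\<Union>i. A i)|lborel. f' x) = (\<Sum>i. LINT x:A i|lborel. f' x)"
      using A union by (intro lebesgue_integral_countable_add) (auto simp: disjoint_family_on_def)
    then show ?case using union by simp
  qed
  have "AE x in lborel. f' x = 0"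
  proof (rule density_unique_real[OF int])
    show "(LINT x:A|lborel. f' x) = (LINT x:A|lborel. 0)" if "A \<in> sets lborel" for A
      using sets0[of A] that unfolding sets_lborel borel_eq_box by simp
  qed auto
  then have "AE x in lebesgue. f' x = 0" by (rule AE_completion)
  with ae' show ?thesis by eventually_elim simp
qed

text \<open>Local integrability of \<open>f\<close> gives control only on compact subsets of \<open>\<Omega>\<close>.  The claim is
  therefore proved on each open box whose closed box lies in \<open>\<Omega>\<close>, and countably many of these
  boxes cover \<open>\<Omega>\<close>.\<close>
lemma fundamental_lemma_calculus_of_variations:
  fixes f :: "'a::euclidean_space \<Rightarrow> real"
  assumes f: "locally_integrable \<Omega> f" and \<Omega>: "open \<Omega>"
    and orth: "\<And>\<psi>. \<psi> \<in> test_functions \<Omega> \<Longrightarrow> (LINT x|lebesgue_on \<Omega>. f x * \<psi> x) = 0"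
  shows "AE x in lebesgue_on \<Omega>. f x = 0"
proof -
  have L: "\<Omega> \<in> sets lebesgue" using \<Omega> by auto
  have ae_box: "AE x in lebesgue. x \<in> box a b \<longrightarrow> f x = 0" if sub: "cbox a b \<subseteq> \<Omega>" for a b
  proof -
    have box0: "(LINT x|lebesgue. indicator (box c d) x * f x) = 0" if "cbox c d \<subseteq> \<Omega>" for c d
      by (rule integral_box_eq_0[OF f L orth that])
    have "integrable lebesgue (\<lambda>x. indicator (cbox a b) x *\<^sub>R f x)"
      using f sub unfolding locally_integrable_def by (subst integrable_restrict_space[symmetric]) auto
    then have "integrable lebesgue (\<lambda>x. indicator (box a b) x *\<^sub>R (indicator (cbox a b) x *\<^sub>R f x))"
      by (rule integrable_mult_indicator[rotated]) auto
    also have "(\<lambda>x. indicator (box a b) x *\<^sub>R (indicator (cbox a b) x *\<^sub>R f x)) = (\<lambda>x. indicator (box a b) x * f x)"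
      using box_subset_cbox[of a b] by (auto simp: fun_eq_iff split: split_indicator)
    finally have i: "integrable lebesgue (\<lambda>x. indicator (box a b) x * f x)" .
    have "AE x in lebesgue. indicator (box a b) x * f x = 0"
    proof (rule AE_eq_0_if_box_integrals_eq_0[OF i box0[OF sub]])
      fix c d :: 'a
      have eq: "(\<lambda>x. indicator (box c d) x * (indicator (box a b) x * f x)) = (\<lambda>x. indicator (box c d \<inter> box a b) x * f x)"
        by (auto simp: fun_eq_iff split: split_indicator)
      obtain p q where pq: "box c d \<inter> box a b = box p q" unfolding box_Int_box by blast
      show "(LINT x|lebesgue. indicator (box c d) x * (indicator (box a b) x * f x)) = 0"
      proof (cases "box p q = {}")
        case True
        then show ?thesis unfolding eq pq by simp
      next
        case False
        then have "cbox p q \<subseteq> cbox a b"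
          by (metis pq closure_box closure_minimal closed_cbox box_subset_cbox inf.cobounded2 order_trans)
        then show ?thesis unfolding eq pq using sub box0 by blast
      qed
    qed
    then show ?thesis by (rule eventually_mono) (auto split: split_indicator_asm)
  qed
  define \<F> where "\<F> = {box a b |a b. cbox a b \<subseteq> \<Omega>}"
  have un: "\<Union>\<F> = \<Omega>"
  proof (intro equalityI subsetI)
    fix x assume "x \<in> \<Union>\<F>"
    then show "x \<in> \<Omega>" using box_subset_cbox unfolding \<F>_def by blast
  next
    fix x assume "x \<in> \<Omega>"
    with \<Omega> obtain a b where "cbox a b \<subseteq> \<Omega>" "x \<in> box a b" by (rule open_contains_cbox)
    then show "x \<in> \<Union>\<F>" unfolding \<F>_def by blast
  qed
  obtain \<F>' where \<F>': "\<F>' \<subseteq> \<F>" "countable \<F>'" "\<Union>\<F>' = \<Union>\<F>"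
    by (rule Lindelof[of \<F>]) (auto simp: \<F>_def)
  have "AE x in lebesgue. \<forall>U\<in>\<F>'. x \<in> U \<longrightarrow> f x = 0"
    by (rule AE_ball_countable'[OF _ \<F>'(2)]) (use \<F>'(1) ae_box in \<open>auto simp: \<F>_def\<close>)
  then have "AE x in lebesgue. x \<in> \<Omega> \<longrightarrow> f x = 0"
    by (rule eventually_mono) (use \<F>'(3) un in blast)
  then show ?thesis using L by (simp add: AE_restrict_space_iff)
qed

section \<open>Weak derivatives and the spaces \<open>H\<^sup>1\<close> and \<open>H\<^sup>2\<close>\<close>

text \<open>Because \<open>weak_partial\<close> is an arbitrary choice among weak derivatives, this is what makes any
  statement about it possible: square integrability, linearity and agreement with the
  classical derivative are all transferred along it.\<close>
lemma has_weak_partial_unique: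
  fixes u :: "'a::euclidean_space \<Rightarrow> real"
  assumes \<Omega>: "open \<Omega>" and w: "has_weak_partial \<Omega> i u w" and v: "has_weak_partial \<Omega> i u v"
  shows "AE x in lebesgue_on \<Omega>. w x = v x"
proof -
  have li: "locally_integrable \<Omega> w" "locally_integrable \<Omega> v"
    using w v by (auto simp: has_weak_partial_def)
  have "AE x in lebesgue_on \<Omega>. w x - v x = 0"
  proof (rule fundamental_lemma_calculus_of_variations[OF _ \<Omega>])
    show "locally_integrable \<Omega> (\<lambda>x. w x - v x)"
      using li by (auto simp: locally_integrable_def)
    fix \<psi> assume \<psi>: "\<psi> \<in> test_functions \<Omega>"
    have "integrable (lebesgue_on \<Omega>) (\<lambda>x. w x * \<psi> x)" "integrable (lebesgue_on \<Omega>) (\<lambda>x. v x * \<psi> x)"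
      using \<Omega> by (intro integrable_mult_test_function li \<psi>; simp)+
    then show "(LINT x|lebesgue_on \<Omega>. (w x - v x) * \<psi> x) = 0"
      using w v \<psi> by (simp add: has_weak_partial_def left_diff_distrib)
  qed
  then show ?thesis by simp
qed

lemma has_weak_partial_diff:
  fixes u v :: "'a::euclidean_space \<Rightarrow> real"
  assumes \<Omega>: "open \<Omega>" and i: "i \<in> Basis"
    and u: "has_weak_partial \<Omega> i u u'" and v: "has_weak_partial \<Omega> i v v'"
  shows "has_weak_partial \<Omega> i (\<lambda>x. u x - v x) (\<lambda>x. u' x - v' x)"
  unfolding has_weak_partial_def
proof (intro conjI ballI)
  have li: "locally_integrable \<Omega> u" "locally_integrable \<Omega> v" "locally_integrable \<Omega> u'" "locally_integrable \<Omega> v'"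
    using u v by (auto simp: has_weak_partial_def)
  then show "locally_integrable \<Omega> (\<lambda>x. u x - v x)" "locally_integrable \<Omega> (\<lambda>x. u' x - v' x)"
    by (auto simp: locally_integrable_def)
  fix \<psi> assume \<psi>: "\<psi> \<in> test_functions \<Omega>"
  have L: "\<Omega> \<in> sets lebesgue" using \<Omega> by simp
  note int = li(1,2)[THEN integrable_mult_pderivative_test_function, OF \<psi> i L]
    li(3,4)[THEN integrable_mult_test_function, OF \<psi> L]
  show "(LINT x|lebesgue_on \<Omega>. (u x - v x) * pderivative i \<psi> x) = - (LINT x|lebesgue_on \<Omega>. (u' x - v' x) * \<psi> x)"
    using u v \<psi> int by (simp add: has_weak_partial_def left_diff_distrib)
qed

text \<open>Lebesgue measure is complete; hence measurability, and with it membership in the function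
  spaces below, survives a change on a null set.\<close>
lemma borel_measurable_lebesgue_on_cong_AE:
  fixes f g :: "'a::euclidean_space \<Rightarrow> real"
  assumes f: "f \<in> borel_measurable (lebesgue_on \<Omega>)" and ae: "AE x in lebesgue_on \<Omega>. f x = g x"
    and \<Omega>: "\<Omega> \<in> sets lebesgue"
  shows "g \<in> borel_measurable (lebesgue_on \<Omega>)"
proof (rule borel_measurable_if_D, rule borel_measurable_AE[OF borel_measurable_if_I[OF f \<Omega>]])
  show "AE x in lebesgue. (if x \<in> \<Omega> then f x else 0) = (if x \<in> \<Omega> then g x else 0)"
    using ae \<Omega> by (auto simp: AE_restrict_space_iff elim: eventually_mono)
qed

lemma L2_space_cong_AE:
  fixes f g :: "'a::euclidean_space \<Rightarrow> real"
  assumes f: "f \<in> L2_space \<Omega>" and ae: "AE x in lebesgue_on \<Omega>. f x = g x" and \<Omega>: "\<Omega> \<in> sets lebesgue"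
  shows "g \<in> L2_space \<Omega>"
proof -
  have g: "g \<in> borel_measurable (lebesgue_on \<Omega>)"
    using f by (intro borel_measurable_lebesgue_on_cong_AE[OF _ ae \<Omega>]) (simp add: L2_space_def)
  have "integrable (lebesgue_on \<Omega>) (\<lambda>x. (g x)\<^sup>2)"
  proof (rule integrable_cong_AE_imp)
    show "integrable (lebesgue_on \<Omega>) (\<lambda>x. (f x)\<^sup>2)" using f by (simp add: L2_space_def)
    show "AE x in lebesgue_on \<Omega>. (f x)\<^sup>2 = (g x)\<^sup>2" using ae by eventually_elim simp
  qed (use g in measurable)
  with g show ?thesis by (simp add: L2_space_def)
qed

lemma locally_integrable_cong_AE:
  fixes f g :: "'a::euclidean_space \<Rightarrow> real"
  assumes f: "locally_integrable \<Omega> f" and ae: "AE x in lebesgue_on \<Omega>. f x = g x" and \<Omega>: "\<Omega> \<in> sets lebesgue"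
  shows "locally_integrable \<Omega> g"
  unfolding locally_integrable_def
proof (intro allI impI)
  fix K :: "'a set" assume K: "compact K \<and> K \<subseteq> \<Omega>"
  then have KL: "K \<in> sets lebesgue" by (simp add: borel_compact)
  have aeK: "AE x in lebesgue_on K. f x = g x"
    using ae K KL \<Omega> by (auto simp: AE_restrict_space_iff elim: eventually_mono)
  have i: "integrable (lebesgue_on K) f" using f K by (auto simp: locally_integrable_def)
  then have "g \<in> borel_measurable (lebesgue_on K)"
    by (intro borel_measurable_lebesgue_on_cong_AE[OF _ aeK KL] borel_measurable_integrable)
  then show "integrable (lebesgue_on K) g" using integrable_cong_AE_imp[OF i _ aeK] by blast
qed

lemma has_weak_partial_cong_AE:
  fixes u v :: "'a::euclidean_space \<Rightarrow> real"
  assumes u: "has_weak_partial \<Omega> i u w" and ae: "AE x in lebesgue_on \<Omega>. u x = v x" and \<Omega>: "\<Omega> \<in> sets lebesgue"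
    and i: "i \<in> Basis"
  shows "has_weak_partial \<Omega> i v w"
  unfolding has_weak_partial_def
proof (intro conjI ballI)
  have li: "locally_integrable \<Omega> u" using u by (simp add: has_weak_partial_def)
  then show lv: "locally_integrable \<Omega> v" by (rule locally_integrable_cong_AE[OF _ ae \<Omega>])
  show "locally_integrable \<Omega> w" using u by (simp add: has_weak_partial_def)
  fix \<psi> assume \<psi>: "\<psi> \<in> test_functions \<Omega>"
  have "(LINT x|lebesgue_on \<Omega>. v x * pderivative i \<psi> x) = (LINT x|lebesgue_on \<Omega>. u x * pderivative i \<psi> x)"
  proof (rule integral_cong_AE)
    show "(\<lambda>x. v x * pderivative i \<psi> x) \<in> borel_measurable (lebesgue_on \<Omega>)"
      "(\<lambda>x. u x * pderivative i \<psi> x) \<in> borel_measurable (lebesgue_on \<Omega>)"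
      using li lv by (blast intro: borel_measurable_integrable integrable_mult_pderivative_test_function[OF _ \<psi> i \<Omega>])+
    show "AE x in lebesgue_on \<Omega>. v x * pderivative i \<psi> x = u x * pderivative i \<psi> x"
      using ae by eventually_elim simp
  qed
  then show "(LINT x|lebesgue_on \<Omega>. v x * pderivative i \<psi> x) = - (LINT x|lebesgue_on \<Omega>. w x * \<psi> x)"
    using u \<psi> by (simp add: has_weak_partial_def)
qed

lemma
  fixes u :: "'a::euclidean_space \<Rightarrow> real"
  assumes \<Omega>: "open \<Omega>" and i: "i \<in> Basis" and w: "has_weak_partial \<Omega> i u w"
  shows has_weak_partial_weak_partial: "has_weak_partial \<Omega> i u (weak_partial \<Omega> i u)"
    and weak_partial_eq_AE: "AE x in lebesgue_on \<Omega>. w x = weak_partial \<Omega> i u x"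
proof -
  show *: "has_weak_partial \<Omega> i u (weak_partial \<Omega> i u)"
    using someI[of "has_weak_partial \<Omega> i u", OF w] by (simp add: weak_partial_def)
  show "AE x in lebesgue_on \<Omega>. w x = weak_partial \<Omega> i u x"
    by (rule has_weak_partial_unique[OF \<Omega> w *])
qed

lemma H_space_1_iff:
  "u \<in> H_space 1 \<Omega> \<longleftrightarrow> u \<in> L2_space \<Omega> \<and> (\<forall>i\<in>Basis. \<exists>w\<in>L2_space \<Omega>. has_weak_partial \<Omega> i u w)"
  by simp

lemma H_space_1_weak_partial:
  assumes "open \<Omega>" "i \<in> Basis" "u \<in> H_space 1 \<Omega>"
  shows "has_weak_partial \<Omega> i u (weak_partial \<Omega> i u)" "weak_partial \<Omega> i u \<in> L2_space \<Omega>"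
proof -
  obtain w where w: "w \<in> L2_space \<Omega>" "has_weak_partial \<Omega> i u w" using assms H_space_1_iff by blast
  show "has_weak_partial \<Omega> i u (weak_partial \<Omega> i u)"
    by (rule has_weak_partial_weak_partial[OF assms(1,2) w(2)])
  show "weak_partial \<Omega> i u \<in> L2_space \<Omega>"
    using L2_space_cong_AE[OF w(1) weak_partial_eq_AE[OF assms(1,2) w(2)]] assms(1) by simp
qed

lemma H_space_2_weak_partial:
  fixes u :: "'a::euclidean_space \<Rightarrow> real"
  assumes \<Omega>: "open \<Omega>" and i: "i \<in> Basis" and u: "u \<in> H_space 2 \<Omega>"
  shows "weak_partial \<Omega> i u \<in> H_space 1 \<Omega>"
proof -
  have "u \<in> H_space (Suc 1) \<Omega>" using u by (simp only: numeral_2_eq_2 One_nat_def)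
  then obtain w where w: "w \<in> H_space 1 \<Omega>" "has_weak_partial \<Omega> i u w"
    using i unfolding H_space.simps(2)[of 1] by blast
  have L: "\<Omega> \<in> sets lebesgue" using \<Omega> by simp
  note ae = weak_partial_eq_AE[OF \<Omega> i w(2)]
  show ?thesis
    unfolding H_space_1_iff
  proof (intro conjI ballI)
    show "weak_partial \<Omega> i u \<in> L2_space \<Omega>"
      using w(1) H_space_1_iff by (blast intro: L2_space_cong_AE[OF _ ae L])
    fix j :: 'a assume j: "j \<in> Basis"
    obtain w' where "w' \<in> L2_space \<Omega>" "has_weak_partial \<Omega> j w w'" using w(1) j H_space_1_iff by blast
    then show "\<exists>w\<in>L2_space \<Omega>. has_weak_partial \<Omega> j (weak_partial \<Omega> i u) w"
      using has_weak_partial_cong_AE[OF _ ae L j] by blast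
  qed
qed

section \<open>The geometry of \<open>L\<^sup>2\<close>\<close>

lemma L2_spaceD:
  assumes "f \<in> L2_space \<Omega>"
  shows "f \<in> borel_measurable (lebesgue_on \<Omega>)" "integrable (lebesgue_on \<Omega>) (\<lambda>x. (f x)\<^sup>2)"
  using assms by (auto simp: L2_space_def)

lemma L2_mult_integrable:
  fixes f g :: "'a::euclidean_space \<Rightarrow> real"
  assumes "f \<in> L2_space \<Omega>" "g \<in> L2_space \<Omega>"
  shows "integrable (lebesgue_on \<Omega>) (\<lambda>x. f x * g x)"
proof (rule Bochner_Integration.integrable_bound)
  note [measurable] = assms[THEN L2_spaceD(1)]
  show "integrable (lebesgue_on \<Omega>) (\<lambda>x. (f x)\<^sup>2 + (g x)\<^sup>2)" using assms[THEN L2_spaceD(2)] by simp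
  show "(\<lambda>x. f x * g x) \<in> borel_measurable (lebesgue_on \<Omega>)" by measurable
  have "\<bar>a * b\<bar> \<le> a\<^sup>2 + b\<^sup>2" for a b :: real
  proof -
    have "2 * (\<bar>a\<bar> * \<bar>b\<bar>) \<le> a\<^sup>2 + b\<^sup>2"
      using zero_le_power2[of "\<bar>a\<bar> - \<bar>b\<bar>"] by (simp add: power2_diff)
    moreover have "0 \<le> \<bar>a\<bar> * \<bar>b\<bar>" by simp
    ultimately show ?thesis unfolding abs_mult by linarith
  qed
  then show "AE x in lebesgue_on \<Omega>. norm (f x * g x) \<le> norm ((f x)\<^sup>2 + (g x)\<^sup>2)"
    by (auto intro: order_trans)
qed

lemma L2_space_add:
  assumes "f \<in> L2_space \<Omega>" "g \<in> L2_space \<Omega>"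
  shows "(\<lambda>x. f x + g x) \<in> L2_space \<Omega>"
proof -
  note [measurable] = assms[THEN L2_spaceD(1)]
  show ?thesis
    using assms[THEN L2_spaceD(2)] L2_mult_integrable[OF assms]
    by (simp add: L2_space_def power2_sum mult.assoc)
qed

lemma L2_space_cmult: "f \<in> L2_space \<Omega> \<Longrightarrow> (\<lambda>x. c * f x) \<in> L2_space \<Omega>"
  by (auto simp: L2_space_def power_mult_distrib)

lemma L2_space_diff:
  assumes "f \<in> L2_space \<Omega>" "g \<in> L2_space \<Omega>"
  shows "(\<lambda>x. f x - g x) \<in> L2_space \<Omega>"
  using L2_space_add[OF assms(1) L2_space_cmult[OF assms(2), of "-1"]] by simp

lemma L2_norm_nonneg: "0 \<le> L2_norm \<Omega> f"
  by (simp add: L2_norm_def)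

lemma L2_norm_power2: "(L2_norm \<Omega> f)\<^sup>2 = (LINT x|lebesgue_on \<Omega>. (f x)\<^sup>2)"
  by (simp add: L2_norm_def)

lemma L2_norm_cong_AE:
  assumes "f \<in> L2_space \<Omega>" "g \<in> L2_space \<Omega>" "AE x in lebesgue_on \<Omega>. f x = g x"
  shows "L2_norm \<Omega> f = L2_norm \<Omega> g"
proof -
  note [measurable] = assms(1,2)[THEN L2_spaceD(1)]
  have "(LINT x|lebesgue_on \<Omega>. (f x)\<^sup>2) = (LINT x|lebesgue_on \<Omega>. (g x)\<^sup>2)"
  proof (rule integral_cong_AE)
    show "AE x in lebesgue_on \<Omega>. (f x)\<^sup>2 = (g x)\<^sup>2" using assms(3) by eventually_elim simp
  qed measurable
  then show ?thesis by (simp add: L2_norm_def)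
qed

lemma L2_Cauchy_Schwarz:
  assumes f: "f \<in> L2_space \<Omega>" and g: "g \<in> L2_space \<Omega>"
  shows "\<bar>LINT x|lebesgue_on \<Omega>. f x * g x\<bar> \<le> L2_norm \<Omega> f * L2_norm \<Omega> g"
proof -
  define A B C where "A = (LINT x|lebesgue_on \<Omega>. (f x)\<^sup>2)" and "B = (LINT x|lebesgue_on \<Omega>. (g x)\<^sup>2)"
    and "C = (LINT x|lebesgue_on \<Omega>. f x * g x)"
  note int = f[THEN L2_spaceD(2)] g[THEN L2_spaceD(2)] L2_mult_integrable[OF f g]
  have q: "0 \<le> A + 2 * t * C + t\<^sup>2 * B" for t
  proof -
    have "0 \<le> (LINT x|lebesgue_on \<Omega>. (f x + t * g x)\<^sup>2)" by simp
    also have "\<dots> = (LINT x|lebesgue_on \<Omega>. (f x)\<^sup>2 + 2 * t * (f x * g x) + t\<^sup>2 * (g x)\<^sup>2)"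
      by (simp add: power2_sum power_mult_distrib algebra_simps)
    also have "\<dots> = A + 2 * t * C + t\<^sup>2 * B"
      using int by (simp add: A_def B_def C_def)
    finally show ?thesis .
  qed
  have "0 \<le> A" "0 \<le> B" by (simp_all add: A_def B_def)
  have "C\<^sup>2 \<le> A * B"
  proof (cases "B = 0")
    case True
    have "C = 0"
    proof (rule ccontr)
      assume "C \<noteq> 0"
      \<comment> \<open>An affine function of \<open>t\<close> that is bounded below has slope zero.\<close>
      then show False using q[of "- (A + 1) / (2 * C)"] True by (simp add: field_simps)
    qed
    then show ?thesis using True by simp
  next
    case False
    then have "B > 0" using \<open>0 \<le> B\<close> by simp
    \<comment> \<open>The minimiser of the quadratic polynomial.\<close>
    then show ?thesis using q[of "- C / B"] by (simp add: power2_eq_square field_simps)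
  qed
  then have "sqrt (C\<^sup>2) \<le> sqrt (A * B)" by (rule real_sqrt_le_mono)
  then show ?thesis by (simp add: L2_norm_def A_def B_def C_def real_sqrt_mult)
qed

lemma L2_norm_triangle:
  assumes f: "f \<in> L2_space \<Omega>" and g: "g \<in> L2_space \<Omega>"
  shows "L2_norm \<Omega> (\<lambda>x. f x + g x) \<le> L2_norm \<Omega> f + L2_norm \<Omega> g"
proof (rule power2_le_imp_le)
  have "(L2_norm \<Omega> (\<lambda>x. f x + g x))\<^sup>2 = (LINT x|lebesgue_on \<Omega>. (f x)\<^sup>2 + (g x)\<^sup>2 + 2 * (f x * g x))"
    by (simp add: L2_norm_power2 power2_sum algebra_simps)
  also have "\<dots> = (L2_norm \<Omega> f)\<^sup>2 + (L2_norm \<Omega> g)\<^sup>2 + 2 * (LINT x|lebesgue_on \<Omega>. f x * g x)"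
    using f[THEN L2_spaceD(2)] g[THEN L2_spaceD(2)] L2_mult_integrable[OF f g] by (simp add: L2_norm_power2)
  also have "\<dots> \<le> (L2_norm \<Omega> f + L2_norm \<Omega> g)\<^sup>2"
    using L2_Cauchy_Schwarz[OF f g] by (simp add: power2_sum)
  finally show "(L2_norm \<Omega> (\<lambda>x. f x + g x))\<^sup>2 \<le> (L2_norm \<Omega> f + L2_norm \<Omega> g)\<^sup>2" .
qed (simp add: L2_norm_nonneg)

lemma L2_norm_minus_commute: "L2_norm \<Omega> (\<lambda>x. f x - g x) = L2_norm \<Omega> (\<lambda>x. g x - f x)"
  by (simp add: L2_norm_def power2_commute)

lemma L2_norm_triangle_diff:
  assumes "f \<in> L2_space \<Omega>" "g \<in> L2_space \<Omega>"
  shows "L2_norm \<Omega> f \<le> L2_norm \<Omega> (\<lambda>x. f x - g x) + L2_norm \<Omega> g"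
  using L2_norm_triangle[OF L2_space_diff[OF assms] assms(2)] by simp

section \<open>The space \<open>H\<^sup>1\<^sub>0\<close>\<close>

lemma test_function_L2:
  fixes \<psi> :: "'a::euclidean_space \<Rightarrow> real"
  assumes \<psi>: "\<psi> \<in> test_functions \<Omega>" and \<Omega>: "\<Omega> \<in> sets lebesgue" and i: "i \<in> Basis"
  shows "\<psi> \<in> L2_space \<Omega>" "pderivative i \<psi> \<in> L2_space \<Omega>"
proof -
  have *: "f \<in> L2_space \<Omega>" if c: "continuous_on UNIV f" and K: "compact K" "K \<subseteq> \<Omega>" "\<And>x. x \<notin> K \<Longrightarrow> f x = 0"
    for f :: "'a \<Rightarrow> real" and K
  proof -
    have m: "f \<in> borel_measurable borel" by (rule borel_measurable_continuous_onI[OF c])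
    have "integrable (lebesgue_on \<Omega>) (\<lambda>x. f x * f x)"
      by (rule integrable_mult_compact_support[OF continuous_imp_locally_integrable[OF c] K c \<Omega>])
    moreover have "f \<in> borel_measurable (lebesgue_on \<Omega>)"
      by (rule measurable_restrict_space1, rule measurable_completion) (simp add: m)
    ultimately show ?thesis by (simp add: L2_space_def power2_eq_square)
  qed
  obtain K where K: "compact K" "K \<subseteq> \<Omega>" "\<And>x. x \<notin> K \<Longrightarrow> \<psi> x = 0"
    using test_functions_compact_support[OF \<psi>] by blast
  show "\<psi> \<in> L2_space \<Omega>"
    by (rule *[OF Ck_imp_continuous_on[OF test_functions_Ck[OF \<psi>]] K])
  show "pderivative i \<psi> \<in> L2_space \<Omega>"
    by (rule *[OF continuous_on_pderivative[OF test_functions_Ck[OF \<psi>] i] K(1,2)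
          pderivative_eq_0_outside_closed[OF compact_imp_closed[OF K(1)] K(3)]])
qed

lemma norm_weak_gradient_power2:
  "(norm (weak_gradient \<Omega> u x))\<^sup>2 = (\<Sum>i\<in>Basis. (weak_partial \<Omega> i u x)\<^sup>2)"
proof -
  have "weak_gradient \<Omega> u x \<bullet> i = weak_partial \<Omega> i u x" if "i \<in> Basis" for i
    using that by (simp add: weak_gradient_def inner_sum_left_Basis)
  then show ?thesis
    unfolding power2_norm_eq_inner by (subst euclidean_inner) (simp add: power2_eq_square)
qed

lemma integral_norm_weak_gradient:
  assumes "open \<Omega>" "u \<in> H_space 1 \<Omega>"
  shows "(LINT x|lebesgue_on \<Omega>. (norm (weak_gradient \<Omega> u x))\<^sup>2) = (\<Sum>i\<in>Basis. (L2_norm \<Omega> (weak_partial \<Omega> i u))\<^sup>2)"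
  unfolding norm_weak_gradient_power2 L2_norm_power2
  by (rule Bochner_Integration.integral_sum) (rule L2_spaceD(2)[OF H_space_1_weak_partial(2)[OF assms(1) _ assms(2)]])

lemma H1_norm_power2:
  assumes "open \<Omega>" "u \<in> H_space 1 \<Omega>"
  shows "H1_norm \<Omega> u = sqrt ((L2_norm \<Omega> u)\<^sup>2 + (\<Sum>i\<in>Basis. (L2_norm \<Omega> (weak_partial \<Omega> i u))\<^sup>2))"
  using integral_norm_weak_gradient[OF assms] by (simp add: H1_norm_def L2_norm_power2)

lemma H_space_1_diff:
  assumes \<Omega>: "open \<Omega>" and u: "u \<in> H_space 1 \<Omega>" and v: "v \<in> H_space 1 \<Omega>"
  shows "(\<lambda>x. u x - v x) \<in> H_space 1 \<Omega>"
    and "i \<in> Basis \<Longrightarrow> AE x in lebesgue_on \<Omega>. weak_partial \<Omega> i u x - weak_partial \<Omega> i v x = weak_partial \<Omega> i (\<lambda>x. u x - v x) x"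
proof -
  have *: "has_weak_partial \<Omega> i (\<lambda>x. u x - v x) (\<lambda>x. weak_partial \<Omega> i u x - weak_partial \<Omega> i v x)"
    if "i \<in> Basis" for i
    using that by (intro has_weak_partial_diff H_space_1_weak_partial assms)
  show "(\<lambda>x. u x - v x) \<in> H_space 1 \<Omega>"
    unfolding H_space_1_iff
  proof (intro conjI ballI)
    show "(\<lambda>x. u x - v x) \<in> L2_space \<Omega>" using u v H_space_1_iff by (blast intro: L2_space_diff)
    show "\<exists>w\<in>L2_space \<Omega>. has_weak_partial \<Omega> i (\<lambda>x. u x - v x) w" if "i \<in> Basis" for i
      using that * by (blast intro: L2_space_diff H_space_1_weak_partial assms)
  qed
  show "AE x in lebesgue_on \<Omega>. weak_partial \<Omega> i u x - weak_partial \<Omega> i v x = weak_partial \<Omega> i (\<lambda>x. u x - v x) x"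
    if "i \<in> Basis"
    by (rule weak_partial_eq_AE[OF \<Omega> that *[OF that]])
qed

lemma test_function_H_space_1:
  fixes \<psi> :: "'a::euclidean_space \<Rightarrow> real"
  assumes \<psi>: "\<psi> \<in> test_functions \<Omega>" and \<Omega>: "open \<Omega>"
  shows "\<psi> \<in> H_space 1 \<Omega>"
    and "i \<in> Basis \<Longrightarrow> AE x in lebesgue_on \<Omega>. pderivative i \<psi> x = weak_partial \<Omega> i \<psi> x"
proof -
  have L: "\<Omega> \<in> sets lebesgue" using \<Omega> by simp
  obtain b :: 'a where "b \<in> Basis" using nonempty_Basis by blast
  then show "\<psi> \<in> H_space 1 \<Omega>"
    unfolding H_space_1_iff using test_function_L2[OF \<psi> L] test_function_has_weak_partial[OF \<psi> \<Omega>] by blast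
  show "AE x in lebesgue_on \<Omega>. pderivative i \<psi> x = weak_partial \<Omega> i \<psi> x" if "i \<in> Basis"
    by (rule weak_partial_eq_AE[OF \<Omega> that test_function_has_weak_partial[OF \<psi> \<Omega> that]])
qed

lemma weak_partial_diff_test_function:
  fixes \<psi> :: "'a::euclidean_space \<Rightarrow> real"
  assumes \<Omega>: "open \<Omega>" and w: "w \<in> H_space 1 \<Omega>" and \<psi>: "\<psi> \<in> test_functions \<Omega>" and i: "i \<in> Basis"
  shows "L2_norm \<Omega> (weak_partial \<Omega> i (\<lambda>x. w x - \<psi> x)) = L2_norm \<Omega> (\<lambda>x. weak_partial \<Omega> i w x - pderivative i \<psi> x)"
proof (rule L2_norm_cong_AE)
  have L: "\<Omega> \<in> sets lebesgue" using \<Omega> by simp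
  note \<psi>H = test_function_H_space_1[OF \<psi> \<Omega>]
  note d = H_space_1_diff[OF \<Omega> w \<psi>H(1)]
  show "weak_partial \<Omega> i (\<lambda>x. w x - \<psi> x) \<in> L2_space \<Omega>"
    by (rule H_space_1_weak_partial(2)[OF \<Omega> i d(1)])
  show "(\<lambda>x. weak_partial \<Omega> i w x - pderivative i \<psi> x) \<in> L2_space \<Omega>"
    by (intro L2_space_diff H_space_1_weak_partial(2)[OF \<Omega> i w] test_function_L2(2)[OF \<psi> L i])
  show "AE x in lebesgue_on \<Omega>. weak_partial \<Omega> i (\<lambda>x. w x - \<psi> x) x = weak_partial \<Omega> i w x - pderivative i \<psi> x"
    using d(2)[OF i] \<psi>H(2)[OF i] by eventually_elim simp
qed

text \<open>The \<open>H\<^sup>1\<close> norm in the definition of \<open>H\<^sup>1\<^sub>0\<close> involves chosen weak derivatives of the difference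
  \<open>w - \<psi>\<close>.  Here it is split into single \<open>L\<^sup>2\<close> norms with the classical derivatives of \<open>\<psi>\<close>, the
  form in which identities for test functions pass to the limit.\<close>
lemma H10_space_approx:
  fixes w :: "'a::euclidean_space \<Rightarrow> real"
  assumes \<Omega>: "open \<Omega>" and w: "w \<in> H10_space \<Omega>" and e: "e > 0"
  shows "\<exists>\<psi>\<in>test_functions \<Omega>. L2_norm \<Omega> (\<lambda>x. w x - \<psi> x) < e \<and>
    (\<forall>i\<in>Basis. L2_norm \<Omega> (\<lambda>x. weak_partial \<Omega> i w x - pderivative i \<psi> x) < e)"
proof -
  have wH: "w \<in> H_space 1 \<Omega>" using w by (simp only: H10_space_def mem_Collect_eq)
  obtain \<psi> where \<psi>: "\<psi> \<in> test_functions \<Omega>" and lt: "H1_norm \<Omega> (\<lambda>x. w x - \<psi> x) < e"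
    using w e unfolding H10_space_def by blast
  note d = H_space_1_diff(1)[OF \<Omega> wH test_function_H_space_1(1)[OF \<psi> \<Omega>]]
  show ?thesis
  proof (intro bexI[OF _ \<psi>] conjI ballI)
    have "L2_norm \<Omega> (\<lambda>x. w x - \<psi> x) \<le> H1_norm \<Omega> (\<lambda>x. w x - \<psi> x)"
      unfolding H1_norm_power2[OF \<Omega> d] by (intro real_le_rsqrt) (simp add: sum_nonneg)
    with lt show "L2_norm \<Omega> (\<lambda>x. w x - \<psi> x) < e" by simp
    fix i :: 'a assume i: "i \<in> Basis"
    have "(L2_norm \<Omega> (weak_partial \<Omega> i (\<lambda>x. w x - \<psi> x)))\<^sup>2 \<le> (\<Sum>j\<in>Basis. (L2_norm \<Omega> (weak_partial \<Omega> j (\<lambda>x. w x - \<psi> x)))\<^sup>2)"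
      by (rule member_le_sum[OF i]) auto
    also have "\<dots> \<le> (L2_norm \<Omega> (\<lambda>x. w x - \<psi> x))\<^sup>2 + \<dots>" by simp
    finally have "L2_norm \<Omega> (weak_partial \<Omega> i (\<lambda>x. w x - \<psi> x)) \<le> H1_norm \<Omega> (\<lambda>x. w x - \<psi> x)"
      unfolding H1_norm_power2[OF \<Omega> d] by (rule real_le_rsqrt)
    with lt show "L2_norm \<Omega> (\<lambda>x. weak_partial \<Omega> i w x - pderivative i \<psi> x) < e"
      unfolding weak_partial_diff_test_function[OF \<Omega> wH \<psi> i] by simp
  qed
qed

lemma H1_norm_le:
  assumes "open \<Omega>" "u \<in> H_space 1 \<Omega>"
  shows "H1_norm \<Omega> u \<le> L2_norm \<Omega> u + (\<Sum>i\<in>Basis. L2_norm \<Omega> (weak_partial \<Omega> i u))"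
proof -
  have "sqrt (\<Sum>i\<in>Basis. (L2_norm \<Omega> (weak_partial \<Omega> i u))\<^sup>2) \<le> (\<Sum>i\<in>Basis. L2_norm \<Omega> (weak_partial \<Omega> i u))"
    using L2_set_le_sum[of Basis "\<lambda>i. L2_norm \<Omega> (weak_partial \<Omega> i u)"] by (simp add: L2_set_def L2_norm_nonneg)
  moreover have "H1_norm \<Omega> u \<le> sqrt ((L2_norm \<Omega> u)\<^sup>2) + sqrt (\<Sum>i\<in>Basis. (L2_norm \<Omega> (weak_partial \<Omega> i u))\<^sup>2)"
    unfolding H1_norm_power2[OF assms] by (rule sqrt_add_le_add_sqrt) (auto intro: sum_nonneg)
  ultimately show ?thesis by (simp add: L2_norm_nonneg)
qed

lemma H10_space_diff:
  fixes u v :: "'a::euclidean_space \<Rightarrow> real"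
  assumes \<Omega>: "open \<Omega>" and u: "u \<in> H10_space \<Omega>" and v: "v \<in> H10_space \<Omega>"
  shows "(\<lambda>x. u x - v x) \<in> H10_space \<Omega>"
proof -
  have L: "\<Omega> \<in> sets lebesgue" using \<Omega> by simp
  have uH: "u \<in> H_space 1 \<Omega>" and vH: "v \<in> H_space 1 \<Omega>" using u v by (simp_all only: H10_space_def mem_Collect_eq)
  note d = H_space_1_diff[OF \<Omega> uH vH]
  have "\<exists>\<psi>\<in>test_functions \<Omega>. H1_norm \<Omega> (\<lambda>x. (u x - v x) - \<psi> x) < e" if e: "e > 0" for e
  proof -
    \<comment> \<open>There are \<open>N\<close> norms to add up, and each picks up \<open>e'\<close> from \<open>u\<close> and \<open>e'\<close> from \<open>v\<close>.\<close>
    define N where "N = real DIM('a) + 1"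
    have N: "N > 0" unfolding N_def by linarith
    define e' where "e' = e / (4 * N)"
    have e': "e' > 0" using e N by (simp add: e'_def)
    obtain \<psi> where \<psi>: "\<psi> \<in> test_functions \<Omega>" "L2_norm \<Omega> (\<lambda>x. u x - \<psi> x) < e'"
      "\<And>i. i \<in> Basis \<Longrightarrow> L2_norm \<Omega> (\<lambda>x. weak_partial \<Omega> i u x - pderivative i \<psi> x) < e'"
      using H10_space_approx[OF \<Omega> u e'] by blast
    obtain \<eta> where \<eta>: "\<eta> \<in> test_functions \<Omega>" "L2_norm \<Omega> (\<lambda>x. v x - \<eta> x) < e'"
      "\<And>i. i \<in> Basis \<Longrightarrow> L2_norm \<Omega> (\<lambda>x. weak_partial \<Omega> i v x - pderivative i \<eta> x) < e'"
      using H10_space_approx[OF \<Omega> v e'] by blast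
    define a where "a = (\<lambda>x. u x - \<psi> x)"
    define b where "b = (\<lambda>x. v x - \<eta> x)"
    have aH: "a \<in> H_space 1 \<Omega>" and bH: "b \<in> H_space 1 \<Omega>"
      unfolding a_def b_def
      by (rule H_space_1_diff(1)[OF \<Omega> uH test_function_H_space_1(1)[OF \<psi>(1) \<Omega>]],
          rule H_space_1_diff(1)[OF \<Omega> vH test_function_H_space_1(1)[OF \<eta>(1) \<Omega>]])
    have tri: "L2_norm \<Omega> (\<lambda>x. f x - g x) \<le> L2_norm \<Omega> f + L2_norm \<Omega> g"
      if "f \<in> L2_space \<Omega>" "g \<in> L2_space \<Omega>" for f g :: "'a \<Rightarrow> real"
      using L2_norm_triangle[OF that(1) L2_space_cmult[OF that(2), of "-1"]] by (simp add: L2_norm_def)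
    have abH: "(\<lambda>x. a x - b x) \<in> H_space 1 \<Omega>" by (rule H_space_1_diff(1)[OF \<Omega> aH bH])
    have 1: "L2_norm \<Omega> (\<lambda>x. a x - b x) \<le> 2 * e'"
      using tri[of a b] aH bH \<psi>(2) \<eta>(2) unfolding H_space_1_iff a_def[symmetric] b_def[symmetric] by simp
    have 2: "L2_norm \<Omega> (weak_partial \<Omega> i (\<lambda>x. a x - b x)) \<le> 2 * e'" if i: "i \<in> Basis" for i
    proof -
      have aL: "weak_partial \<Omega> i a \<in> L2_space \<Omega>" and bL: "weak_partial \<Omega> i b \<in> L2_space \<Omega>"
        by (rule H_space_1_weak_partial(2)[OF \<Omega> i aH], rule H_space_1_weak_partial(2)[OF \<Omega> i bH])
      have "L2_norm \<Omega> (weak_partial \<Omega> i (\<lambda>x. a x - b x)) = L2_norm \<Omega> (\<lambda>x. weak_partial \<Omega> i a x - weak_partial \<Omega> i b x)"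
        using H_space_1_diff(2)[OF \<Omega> aH bH i]
        by (intro L2_norm_cong_AE L2_space_diff aL bL H_space_1_weak_partial(2)[OF \<Omega> i abH]) (simp add: eq_commute)
      also have "\<dots> \<le> L2_norm \<Omega> (weak_partial \<Omega> i a) + L2_norm \<Omega> (weak_partial \<Omega> i b)"
        by (rule tri[OF aL bL])
      also have "\<dots> \<le> 2 * e'"
        unfolding a_def b_def weak_partial_diff_test_function[OF \<Omega> uH \<psi>(1) i] weak_partial_diff_test_function[OF \<Omega> vH \<eta>(1) i]
        using \<psi>(3)[OF i] \<eta>(3)[OF i] by simp
      finally show ?thesis .
    qed
    show ?thesis
    proof (intro bexI)
      show "(\<lambda>x. \<psi> x - \<eta> x) \<in> test_functions \<Omega>" by (rule test_functions_diff[OF \<psi>(1) \<eta>(1)])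
      have "(\<lambda>x. (u x - v x) - (\<psi> x - \<eta> x)) = (\<lambda>x. a x - b x)" by (auto simp: a_def b_def)
      then have "H1_norm \<Omega> (\<lambda>x. (u x - v x) - (\<psi> x - \<eta> x)) \<le> 2 * e' + (\<Sum>i\<in>(Basis::'a set). 2 * e')"
        using H1_norm_le[OF \<Omega> abH] 1 sum_mono[of Basis "\<lambda>i. L2_norm \<Omega> (weak_partial \<Omega> i (\<lambda>x. a x - b x))" "\<lambda>_. 2 * e'", OF 2]
        by simp
      also have "\<dots> = 2 * (e' * N)" by (simp add: N_def algebra_simps)
      also have "e' * N = e / 4" using N by (simp add: e'_def)
      also have "2 * (e / 4) < e" using e by simp
      finally show "H1_norm \<Omega> (\<lambda>x. (u x - v x) - (\<psi> x - \<eta> x)) < e" .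
    qed
  qed
  then show ?thesis using d(1) unfolding H10_space_def by blast
qed

lemma H10_space_imp_H_space_1: "w \<in> H10_space \<Omega> \<Longrightarrow> w \<in> H_space 1 \<Omega>"
  by (simp only: H10_space_def mem_Collect_eq)

lemma H_space_1_imp_L2_space: "u \<in> H_space 1 \<Omega> \<Longrightarrow> u \<in> L2_space \<Omega>"
  by simp

text \<open>For a test function in place of \<open>w\<close> this is the definition of the weak derivative of \<open>z\<close>.
  By the Cauchy-Schwarz inequality both sides are continuous in \<open>w\<close> for the \<open>H\<^sup>1\<close> norm, so the
  identity extends to the closure of the test functions.\<close>
lemma integration_by_parts_H10:
  fixes w z z' :: "'a::euclidean_space \<Rightarrow> real"
  assumes \<Omega>: "open \<Omega>" and i: "i \<in> Basis" and w: "w \<in> H10_space \<Omega>"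
    and z: "z \<in> L2_space \<Omega>" and z': "z' \<in> L2_space \<Omega>" and zz': "has_weak_partial \<Omega> i z z'"
  shows "(LINT x|lebesgue_on \<Omega>. z x * weak_partial \<Omega> i w x) = - (LINT x|lebesgue_on \<Omega>. z' x * w x)"
proof -
  have L: "\<Omega> \<in> sets lebesgue" using \<Omega> by simp
  define d where "d = weak_partial \<Omega> i w"
  have wH: "w \<in> H_space 1 \<Omega>" by (rule H10_space_imp_H_space_1[OF w])
  have wL: "w \<in> L2_space \<Omega>" by (rule H_space_1_imp_L2_space[OF wH])
  have dL: "d \<in> L2_space \<Omega>" unfolding d_def by (rule H_space_1_weak_partial(2)[OF \<Omega> i wH])
  define E where "E = (LINT x|lebesgue_on \<Omega>. z x * d x) + (LINT x|lebesgue_on \<Omega>. z' x * w x)"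
  define c where "c = L2_norm \<Omega> z + L2_norm \<Omega> z' + 1"
  have c: "c > 0" unfolding c_def using L2_norm_nonneg[of \<Omega> z] L2_norm_nonneg[of \<Omega> z'] by linarith
  have "\<bar>E\<bar> \<le> 0 + e" if e: "e > 0" for e
  proof -
    have ec: "e / c > 0" using e c by simp
    obtain \<psi> where \<psi>: "\<psi> \<in> test_functions \<Omega>" and near: "L2_norm \<Omega> (\<lambda>x. w x - \<psi> x) < e / c"
        "L2_norm \<Omega> (\<lambda>x. d x - pderivative i \<psi> x) < e / c"
      using H10_space_approx[OF \<Omega> w ec] i unfolding d_def by blast
    note \<psi>L = test_function_L2[OF \<psi> L i]
    have "(LINT x|lebesgue_on \<Omega>. z x * pderivative i \<psi> x) + (LINT x|lebesgue_on \<Omega>. z' x * \<psi> x) = 0"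
      using zz' \<psi> by (simp add: has_weak_partial_def)
    then have "E = (LINT x|lebesgue_on \<Omega>. z x * (d x - pderivative i \<psi> x)) + (LINT x|lebesgue_on \<Omega>. z' x * (w x - \<psi> x))"
      using L2_mult_integrable[OF z dL] L2_mult_integrable[OF z \<psi>L(2)]
        L2_mult_integrable[OF z' wL] L2_mult_integrable[OF z' \<psi>L(1)]
      by (simp add: E_def right_diff_distrib)
    then have "\<bar>E\<bar> \<le> L2_norm \<Omega> z * L2_norm \<Omega> (\<lambda>x. d x - pderivative i \<psi> x) + L2_norm \<Omega> z' * L2_norm \<Omega> (\<lambda>x. w x - \<psi> x)"
      using L2_Cauchy_Schwarz[OF z L2_space_diff[OF dL \<psi>L(2)]] L2_Cauchy_Schwarz[OF z' L2_space_diff[OF wL \<psi>L(1)]]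
      by linarith
    also have "\<dots> \<le> L2_norm \<Omega> z * (e / c) + L2_norm \<Omega> z' * (e / c)"
      using near by (intro add_mono mult_left_mono) (auto simp: L2_norm_nonneg)
    also have "\<dots> \<le> c * (e / c)"
      using ec by (simp only: distrib_right[symmetric]) (intro mult_right_mono, auto simp: c_def)
    finally show ?thesis using c by simp
  qed
  then have "\<bar>E\<bar> \<le> 0" by (rule field_le_epsilon)
  then show ?thesis by (simp add: E_def d_def)
qed

lemma Poincare_H10:
  fixes w :: "'a::euclidean_space \<Rightarrow> real"
  assumes i: "i \<in> Basis" and w: "w \<in> H10_space B1"
  shows "L2_norm B1 w \<le> 2 * L2_norm B1 (weak_partial B1 i w)"
proof (rule field_le_epsilon)
  fix e :: real assume "e > 0"
  then have e: "e / 3 > 0" by simp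
  have B: "open (B1::'a set)" "(B1::'a set) \<in> sets lebesgue" by auto
  have wH: "w \<in> H_space 1 B1" by (rule H10_space_imp_H_space_1[OF w])
  have wL: "w \<in> L2_space B1" by (rule H_space_1_imp_L2_space[OF wH])
  obtain \<psi> where \<psi>: "\<psi> \<in> test_functions B1" and near: "L2_norm B1 (\<lambda>x. w x - \<psi> x) < e / 3"
      "L2_norm B1 (\<lambda>x. weak_partial B1 i w x - pderivative i \<psi> x) < e / 3"
    using H10_space_approx[OF B(1) w e] i by blast
  note \<psi>L = test_function_L2[OF \<psi> B(2) i]
  have "(L2_norm B1 \<psi>)\<^sup>2 \<le> (2 * L2_norm B1 (pderivative i \<psi>))\<^sup>2"
    using Poincare_test_function[OF \<psi> i] by (simp add: L2_norm_power2 power_mult_distrib)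
  then have P: "L2_norm B1 \<psi> \<le> 2 * L2_norm B1 (pderivative i \<psi>)"
    by (rule power2_le_imp_le) (simp add: L2_norm_nonneg)
  have "L2_norm B1 w \<le> L2_norm B1 (\<lambda>x. w x - \<psi> x) + L2_norm B1 \<psi>"
    by (rule L2_norm_triangle_diff[OF wL \<psi>L(1)])
  moreover have "L2_norm B1 (pderivative i \<psi>) \<le>
      L2_norm B1 (\<lambda>x. weak_partial B1 i w x - pderivative i \<psi> x) + L2_norm B1 (weak_partial B1 i w)"
    using L2_norm_triangle_diff[OF \<psi>L(2) H_space_1_weak_partial(2)[OF B(1) i wH]]
    by (simp only: L2_norm_minus_commute)
  ultimately show "L2_norm B1 w \<le> 2 * L2_norm B1 (weak_partial B1 i w) + e"
    using P near by linarith
qed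

section \<open>The energy gap and the slope\<close>

lemma L2_B1_integrable:
  fixes f :: "'a::euclidean_space \<Rightarrow> real"
  assumes "f \<in> L2_space B1"
  shows "integrable (lebesgue_on B1) f"
proof -
  interpret finite_measure "lebesgue_on (B1::'a set)"
    by (rule finite_measure_lebesgue_on) simp
  have "(\<lambda>x. 1) \<in> L2_space (B1::'a set)" by (simp add: L2_space_def)
  from L2_mult_integrable[OF assms this] show ?thesis by simp
qed

text \<open>Expanding the square \<open>(norm (\<nabla>u + \<nabla>w))\<^sup>2\<close> with \<open>w = v - u\<close> gives a mixed term, which integration
  by parts turns into \<open>- (LINT x. w x * \<Delta>u x)\<close>; there \<open>w\<close> has zero boundary values and \<open>\<nabla>u\<close> is
  in \<open>H\<^sup>1\<close>.  The quadratic remainder has a sign, which is the strong convexity of the energy.\<close>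
lemma F_ob_expansion:
  fixes u v :: "'a::euclidean_space \<Rightarrow> real"
  assumes u: "u \<in> H_space 2 B1" and uH: "u \<in> H_space 1 B1" and v: "v \<in> H_space 1 B1"
    and w: "(\<lambda>x. v x - u x) \<in> H10_space B1"
  shows "F_ob u - F_ob v = - (LINT x|lebesgue_on B1. (v x - u x) * grad_F_ob u x)
     - 1/2 * (\<Sum>i\<in>Basis. (L2_norm B1 (weak_partial B1 i (\<lambda>x. v x - u x)))\<^sup>2)"
proof -
  have B: "open (B1::'a set)" by auto
  define w where "w = (\<lambda>x. v x - u x)"
  define p q d l where "p i = weak_partial B1 i u" and "q i = weak_partial B1 i v"
    and "d i = weak_partial B1 i w" and "l i = weak_partial B1 i (weak_partial B1 i u)" for i
  have wH: "w \<in> H_space 1 B1" and w0: "w \<in> H10_space B1"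
    using w H10_space_imp_H_space_1 by (auto simp only: w_def)
  note L2 = H_space_1_imp_L2_space[OF uH] H_space_1_imp_L2_space[OF v] H_space_1_imp_L2_space[OF wH]
  have pL: "p i \<in> L2_space B1" and qL: "q i \<in> L2_space B1" and dL: "d i \<in> L2_space B1" and lL: "l i \<in> L2_space B1"
    and pl: "has_weak_partial B1 i (p i) (l i)" if "i \<in> Basis" for i
    unfolding p_def q_def d_def l_def
    using H_space_1_weak_partial[OF B that] uH v wH H_space_2_weak_partial[OF B that u] by blast+
  have q2: "(L2_norm B1 (q i))\<^sup>2 = (L2_norm B1 (p i))\<^sup>2 - 2 * (LINT x|lebesgue_on B1. l i x * w x) + (L2_norm B1 (d i))\<^sup>2"
    if i: "i \<in> Basis" for i
  proof -
    have ae: "AE x in lebesgue_on B1. q i x = p i x + d i x"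
      using H_space_1_diff(2)[OF B v uH i] unfolding p_def q_def d_def w_def by eventually_elim simp
    have "L2_norm B1 (q i) = L2_norm B1 (\<lambda>x. p i x + d i x)"
      by (rule L2_norm_cong_AE[OF qL[OF i] L2_space_add[OF pL[OF i] dL[OF i]] ae])
    then have "(L2_norm B1 (q i))\<^sup>2 = (LINT x|lebesgue_on B1. (p i x)\<^sup>2 + (d i x)\<^sup>2 + 2 * (p i x * d i x))"
      by (simp add: L2_norm_power2 power2_sum mult.assoc)
    also have "\<dots> = (L2_norm B1 (p i))\<^sup>2 + (L2_norm B1 (d i))\<^sup>2 + 2 * (LINT x|lebesgue_on B1. p i x * d i x)"
      using L2_spaceD(2)[OF pL[OF i]] L2_spaceD(2)[OF dL[OF i]] L2_mult_integrable[OF pL[OF i] dL[OF i]]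
      by (simp add: L2_norm_power2)
    also have "(LINT x|lebesgue_on B1. p i x * d i x) = - (LINT x|lebesgue_on B1. l i x * w x)"
      unfolding d_def by (rule integration_by_parts_H10[OF B i w0 pL[OF i] lL[OF i] pl[OF i]])
    finally show ?thesis by simp
  qed
  have lw: "integrable (lebesgue_on B1) (\<lambda>x. l i x * w x)" if "i \<in> Basis" for i
    by (rule L2_mult_integrable[OF lL[OF that] L2(3)])
  have "(LINT x|lebesgue_on B1. w x * grad_F_ob u x) = (LINT x|lebesgue_on B1. w x - (\<Sum>i\<in>Basis. l i x * w x))"
    by (simp add: grad_F_ob_def weak_laplacian_def l_def[abs_def] algebra_simps sum_distrib_left sum_distrib_right)
  also have "\<dots> = (LINT x|lebesgue_on B1. w x) - (\<Sum>i\<in>Basis. LINT x|lebesgue_on B1. l i x * w x)"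
    using lw L2_B1_integrable[OF L2(3)] by (simp add: Bochner_Integration.integral_diff integrable_sum Bochner_Integration.integral_sum)
  finally have g: "(LINT x|lebesgue_on B1. w x * grad_F_ob u x) =
      (LINT x|lebesgue_on B1. w x) - (\<Sum>i\<in>Basis. LINT x|lebesgue_on B1. l i x * w x)" .
  have wi: "(LINT x|lebesgue_on B1. w x) = (LINT x|lebesgue_on B1. v x) - (LINT x|lebesgue_on B1. u x)"
    unfolding w_def using L2_B1_integrable[OF L2(1)] L2_B1_integrable[OF L2(2)] by simp
  have Fu: "F_ob u = 1/2 * (\<Sum>i\<in>Basis. (L2_norm B1 (p i))\<^sup>2) + (LINT x|lebesgue_on B1. u x)"
    unfolding F_ob_def integral_norm_weak_gradient[OF B uH] p_def ..
  have Fv: "F_ob v = 1/2 * (\<Sum>i\<in>Basis. (L2_norm B1 (q i))\<^sup>2) + (LINT x|lebesgue_on B1. v x)"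
    unfolding F_ob_def integral_norm_weak_gradient[OF B v] q_def ..
  have "(\<Sum>i\<in>Basis. (L2_norm B1 (q i))\<^sup>2) = (\<Sum>i\<in>Basis. (L2_norm B1 (p i))\<^sup>2)
      - 2 * (\<Sum>i\<in>Basis. LINT x|lebesgue_on B1. l i x * w x) + (\<Sum>i\<in>Basis. (L2_norm B1 (d i))\<^sup>2)"
    using q2 by (simp add: sum.distrib sum_subtractf sum_distrib_left)
  then have "F_ob u - F_ob v = - (LINT x|lebesgue_on B1. w x * grad_F_ob u x) - 1/2 * (\<Sum>i\<in>Basis. (L2_norm B1 (d i))\<^sup>2)"
    unfolding Fu Fv g wi by (simp add: algebra_simps)
  then show ?thesis unfolding w_def d_def .
qed

lemma L2_norm_eq_0_imp_AE:
  assumes "f \<in> L2_space \<Omega>" "L2_norm \<Omega> f = 0"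
  shows "AE x in lebesgue_on \<Omega>. f x = 0"
proof -
  have "(LINT x|lebesgue_on \<Omega>. (f x)\<^sup>2) = 0" using assms(2) by (simp add: L2_norm_def)
  then have "AE x in lebesgue_on \<Omega>. (f x)\<^sup>2 = 0"
    using integral_nonneg_eq_0_iff_AE[OF L2_spaceD(2)[OF assms(1)]] by simp
  then show ?thesis by eventually_elim simp
qed

theorem proposition4p1:
  shows "\<exists>C::real. C > 0 \<and>
    (\<forall>(g :: 'a::euclidean_space \<Rightarrow> real) \<phi>.
       g \<in> H_space 1 B1 \<longrightarrow>
       (AE x in lebesgue_on B1. g x \<ge> 0) \<longrightarrow>
       is_arg_min F_ob (\<lambda>v. v \<in> K_ob g) \<phi> \<longrightarrow>
       (\<forall>u \<in> H_space 2 B1 \<inter> K_ob g.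
          ereal (sqrt (F_ob u - F_ob \<phi>)) \<le> ereal C * slope_ob g u))"
proof (intro exI[of _ 2] conjI allI impI ballI)
  fix g \<phi> u :: "'a \<Rightarrow> real"
  assume "is_arg_min F_ob (\<lambda>v. v \<in> K_ob g) \<phi>" and "u \<in> H_space 2 B1 \<inter> K_ob g"
  then have \<phi>: "\<phi> \<in> K_ob g" and u: "u \<in> H_space 2 B1" "u \<in> K_ob g"
    by (auto simp only: is_arg_min_def)
  have B: "open (B1::'a set)" by auto
  define w where "w = (\<lambda>x. \<phi> x - u x)"
  have H: "u \<in> H_space 1 B1" "\<phi> \<in> H_space 1 B1" "(\<lambda>x. u x - g x) \<in> H10_space B1" "(\<lambda>x. \<phi> x - g x) \<in> H10_space B1"
    using u(2) \<phi> by (simp_all only: K_ob_def mem_Collect_eq)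
  have w0: "w \<in> H10_space B1"
    using H10_space_diff[OF B H(4) H(3)] by (simp add: w_def)
  have wL: "w \<in> L2_space B1"
    by (rule H_space_1_imp_L2_space[OF H10_space_imp_H_space_1[OF w0]])
  obtain i :: 'a where i: "i \<in> Basis" using nonempty_Basis by blast
  define I n t where "I = - (LINT x|lebesgue_on B1. w x * grad_F_ob u x)"
    and "n = L2_norm B1 w" and "t = L2_norm B1 (weak_partial B1 i w)"
  have P: "n \<le> 2 * t" unfolding n_def t_def by (rule Poincare_H10[OF i w0])
  have n0: "0 \<le> n" by (simp add: n_def L2_norm_nonneg)
  have "t\<^sup>2 \<le> (\<Sum>j\<in>Basis. (L2_norm B1 (weak_partial B1 j w))\<^sup>2)"
    unfolding t_def by (rule member_le_sum[OF i]) auto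
  then have le: "F_ob u - F_ob \<phi> \<le> I - t\<^sup>2 / 2"
    using F_ob_expansion[OF u(1) H(1,2) w0[unfolded w_def]] by (simp add: I_def w_def)
  have slope0: "0 \<le> slope_ob g u" by (simp add: slope_ob_def)
  show "ereal (sqrt (F_ob u - F_ob \<phi>)) \<le> ereal 2 * slope_ob g u"
  proof (cases "F_ob u - F_ob \<phi> \<le> 0")
    case True
    \<comment> \<open>\<open>sqrt\<close> is an odd function on the reals, so it is nonpositive here.\<close>
    then have "ereal (sqrt (F_ob u - F_ob \<phi>)) \<le> 0" by simp
    also have "0 \<le> ereal 2 * slope_ob g u" using slope0 by simp
    finally show ?thesis .
  next
    case False
    \<comment> \<open>A positive energy gap forces \<open>\<phi>\<close> and \<open>u\<close> to differ as classes, so \<open>\<phi>\<close> is admissible in the slope.\<close>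
    have nz: "\<not> (AE x in lebesgue_on B1. \<phi> x = u x)"
    proof
      assume ae: "AE x in lebesgue_on B1. \<phi> x = u x"
      have "I = 0"
        unfolding I_def neg_equal_0_iff_equal
        by (rule integral_eq_zero_AE) (use ae in eventually_elim, simp add: w_def)
      then show False using le False zero_le_power2[of t] by linarith
    qed
    have n: "n > 0"
    proof (rule ccontr)
      assume "\<not> n > 0"
      then have "AE x in lebesgue_on B1. w x = 0"
        using n0 by (intro L2_norm_eq_0_imp_AE[OF wL]) (simp add: n_def)
      then have "AE x in lebesgue_on B1. \<phi> x = u x" by eventually_elim (simp add: w_def)
      then show False using nz by simp
    qed
    \<comment> \<open>The quotient in the slope for the competitor \<open>\<phi>\<close>.\<close>
    define s where "s = I / n"
    have "I > 0" using le False zero_le_power2[of t] by linarith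
    then have s: "s > 0" using n by (simp add: s_def)
    have "ereal s \<le> slope_ob g u"
      unfolding slope_ob_def s_def I_def n_def w_def
      by (rule max.coboundedI2, rule SUP_upper) (use \<phi> nz in simp)
    have "F_ob u - F_ob \<phi> \<le> s * n - t\<^sup>2 / 2" using le n by (simp add: s_def)
    also have "\<dots> \<le> s * (2 * t) - t\<^sup>2 / 2" using P s by simp
    also have "\<dots> \<le> (2 * s)\<^sup>2"
    proof -
      have "4 * (s * t) \<le> 4 * s\<^sup>2 + t\<^sup>2"
        using zero_le_power2[of "2 * s - t"] by (simp add: power2_diff power_mult_distrib)
      moreover have "0 \<le> s\<^sup>2" "s * (2 * t) = 2 * (s * t)" "(2 * s)\<^sup>2 = 4 * s\<^sup>2"
        by (simp_all add: power_mult_distrib)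
      ultimately show ?thesis by linarith
    qed
    finally have "sqrt (F_ob u - F_ob \<phi>) \<le> sqrt ((2 * s)\<^sup>2)" by (rule real_sqrt_le_mono)
    also have "\<dots> = 2 * s" using s by (intro real_sqrt_unique) auto
    finally have "ereal (sqrt (F_ob u - F_ob \<phi>)) \<le> ereal 2 * ereal s" by simp
    also have "\<dots> \<le> ereal 2 * slope_ob g u"
      by (rule ereal_mult_left_mono) (use \<open>ereal s \<le> slope_ob g u\<close> in auto)
    finally show ?thesis .
  qed
qed simp

end
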